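(* Let $p,r\ge1$ and let $H$ be a banded Hessenberg matrix that is exactly periodic with period $r$, with symbol $F(z,x)$, as in the context. Let $x\in\mathbb C$ be such that the solutions $z_k(x)$, $k\in[0:p]$, of the algebraic equation $0=f(z,x)=\det F(z,x)$ are pairwise distinct. Then for each $n\in\mathbb N\cup\{0\}$ and each $j\in[0:r-1]$, $$Q_{rn+j}(x):=\det(xI_{rn+j}-H_{rn+j})=\frac{(-1)^{r+j}}{\mathsf f_p}\sum_{k=0}^p\frac{\det F^{r-1,j}(z_k(x),x)}{\prod_{i=0,\,i\ne k}^p(z_k(x)-z_i(x))}\,z_k(x)^{-n-1}.$$ Here $\mathsf f_p=(-1)^{p(r-p)}\prod_{k=0}^{r-1}b_k^{(p)}$. Moreover, for all $i,j\in[0:r-1]$ and $k\in[0:p]$, $\det F^{i,j}(z_k(x),x)$ is zero for only finitely many $x\in\mathbb C$.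
   Context: Notation: $[i:j]=\{i,i+1,\dots,j\}$. $H=(H_{i,j})_{i,j=0}^\infty$ has $H_{j-1,j}=1$ for $j\ge1$, $H_{j+k,j}=a_j^{(k)}\in\mathbb C$ for $j\ge0$, $k\in[0:p]$, and all other entries $0$; $H_n=(H_{i,j})_{i,j=0}^{n-1}$ (and $\det$ of the empty matrix is $1$). Exactly periodic with period $r$ means $a_{rn+k}^{(j)}=a_k^{(j)}=b_k^{(j)}$ for all $n\in\mathbb N$, $k\in[0:r-1]$, $j\in[0:p]$; it is assumed that $b_k^{(p)}\ne0$ for all $k$. The symbol is $F(z,x)=Z^{-1}+\sum_{k=0}^pZ^k\,\mathrm{diag}(b_0^{(k)},\dots,b_{r-1}^{(k)})-xI_r$, where $Z=\begin{pmatrix}0&z\\ I_{r-1}&0\end{pmatrix}$ is the $r\times r$ cyclic shift matrix ($Z=z$ if $r=1$); $f(z,x)=\det F(z,x)$. For each $x\in\mathbb C$, $f(z,x)=0$ has exactly $p+1$ roots in $z$ counting multiplicities, ordered so that $|z_0(x)|\le\dots\le|z_p(x)|$ (ties labelled arbitrarily). $F^{i,j}$ denotes the submatrix of $F$ obtained by skipping the $i$th row and $j$th column, $i,j\in[0:r-1]$. *)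

theory Defs
  imports
    "HOL-Complex_Analysis.Complex_Analysis"
    "Jordan_Normal_Form.Determinant"
    "Jordan_Normal_Form.Gauss_Jordan_Elimination"
begin

text \<open>
  The coefficient \<open>a\<^sub>j\<^sup>(\<^sup>k\<^sup>)\<close> on the \<open>k\<close>-th subdiagonal, column \<open>j\<close>, is written \<open>a k j\<close>; likewise
  \<open>b k j\<close> for \<open>b\<^sub>j\<^sup>(\<^sup>k\<^sup>)\<close>. All matrix indices start at 0.
\<close>

definition hessenberg :: "nat \<Rightarrow> (nat \<Rightarrow> nat \<Rightarrow> complex) \<Rightarrow> nat \<Rightarrow> nat \<Rightarrow> complex" where
  "hessenberg p a i j =
     (if j = i + 1 then 1
      else if j \<le> i \<and> i \<le> j + p then a (i - j) j
      else 0)"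

definition truncation :: "(nat \<Rightarrow> nat \<Rightarrow> complex) \<Rightarrow> nat \<Rightarrow> complex mat" where
  "truncation H n = Matrix.mat n n (\<lambda>(i, j). H i j)"

definition Q :: "(nat \<Rightarrow> nat \<Rightarrow> complex) \<Rightarrow> nat \<Rightarrow> complex \<Rightarrow> complex" where
  "Q H n x = Determinant.det (x \<cdot>\<^sub>m 1\<^sub>m n - truncation H n)"

definition exactly_periodic ::
    "nat \<Rightarrow> nat \<Rightarrow> (nat \<Rightarrow> nat \<Rightarrow> complex) \<Rightarrow> (nat \<Rightarrow> nat \<Rightarrow> complex) \<Rightarrow> bool" where
  "exactly_periodic p r b a \<longleftrightarrow>
     (\<forall>n. \<forall>k<r. \<forall>j\<le>p. a j (r * n + k) = b j k)"

definition cyclic_shift :: "nat \<Rightarrow> complex \<Rightarrow> complex mat" where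
  "cyclic_shift r z = Matrix.mat r r
     (\<lambda>(i, j). if i = j + 1 then 1 else if i = 0 \<and> j = r - 1 then z else 0)"

lemma cyclic_shift_inverse:
  assumes "r \<ge> 1" and "z \<noteq> 0"
  shows "the (mat_inverse (cyclic_shift r z)) =
    Matrix.mat r r (\<lambda>(i, j). if j = i + 1 then 1 else if i = r - 1 \<and> j = 0 then 1 / z else 0)"
    (is "_ = ?V")
proof -
  let ?Z = "cyclic_shift r z"
  have Z: "?Z \<in> carrier_mat r r" by (simp add: cyclic_shift_def)
  have V: "?V \<in> carrier_mat r r" by simp
  have ZV: "?Z * ?V = 1\<^sub>m r"
  proof (rule eq_matI)
    fix i j assume ij: "i < dim_row (1\<^sub>m r)" "j < dim_col (1\<^sub>m r)"
    then have "(?Z * ?V) $$ (i, j) =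
       (\<Sum>k<r. (if i = k + 1 then 1 else if i = 0 \<and> k = r - 1 then z else 0) *
                (if j = k + 1 then 1 else if k = r - 1 \<and> j = 0 then 1 / z else 0))"
      by (simp add: cyclic_shift_def scalar_prod_def lessThan_atLeast0)
    also have "\<dots> = (\<Sum>k<r. if k = (if i = 0 then r - 1 else i - 1) then (if i = j then 1 else 0) else 0)"
      using ij assms by (intro sum.cong) auto
    also have "\<dots> = 1\<^sub>m r $$ (i, j)"
      using ij assms by (subst sum.delta) auto
    finally show "(?Z * ?V) $$ (i, j) = 1\<^sub>m r $$ (i, j)" .
  qed (use Z V in auto)
  have VZ: "?V * ?Z = 1\<^sub>m r"
    using mat_mult_left_right_inverse[OF Z V ZV] .
  have "?Z \<in> Units (ring_mat TYPE(complex) r ())"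
    using Z V ZV VZ unfolding Units_def ring_mat_def by auto
  then obtain B where B: "mat_inverse ?Z = Some B"
    using mat_inverse(1)[OF Z, where b = "()"] by (cases "mat_inverse ?Z") auto
  then have BZ: "B * ?Z = 1\<^sub>m r" and Bc: "B \<in> carrier_mat r r"
    using mat_inverse(2)[OF Z B] by blast+
  have "B = B * (?Z * ?V)" unfolding ZV using right_mult_one_mat[OF Bc] by (rule sym)
  also have "\<dots> = B * ?Z * ?V" using assoc_mult_mat[OF Bc Z V] by (rule sym)
  also have "\<dots> = ?V" unfolding BZ using V by (rule left_mult_one_mat)
  finally have "B = ?V" .
  with B show ?thesis by simp
qed

text \<open>
  The symbol is meaningful for \<open>z \<noteq> 0\<close> only, where the cyclic shift is invertible.
  The sum over \<open>k\<close> is taken entrywise because the type of matrices of all sizes is not an instance of \<open>comm_monoid_add\<close>.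
\<close>

definition symbol ::
    "nat \<Rightarrow> nat \<Rightarrow> (nat \<Rightarrow> nat \<Rightarrow> complex) \<Rightarrow> complex \<Rightarrow> complex \<Rightarrow> complex mat" where
  "symbol p r b z x =
     the (mat_inverse (cyclic_shift r z))
     + Matrix.mat r r (\<lambda>(i, j). \<Sum>k\<le>p. ((cyclic_shift r z ^\<^sub>m k) * mat_diag r (b k)) $$ (i, j))
     - x \<cdot>\<^sub>m 1\<^sub>m r"

definition symbol_det ::
    "nat \<Rightarrow> nat \<Rightarrow> (nat \<Rightarrow> nat \<Rightarrow> complex) \<Rightarrow> complex \<Rightarrow> complex \<Rightarrow> complex" where
  "symbol_det p r b z x = Determinant.det (symbol p r b z x)"

definition symbol_minor ::
    "nat \<Rightarrow> nat \<Rightarrow> (nat \<Rightarrow> nat \<Rightarrow> complex) \<Rightarrow> nat \<Rightarrow> nat \<Rightarrow> complex \<Rightarrow> complex \<Rightarrow> complex" where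
  "symbol_minor p r b i j z x = Determinant.det (mat_delete (symbol p r b z x) i j)"

text \<open>
  \<open>w 0, \<dots>, w p\<close> list the roots of the equation \<open>f(z, x) = 0\<close> in \<open>z\<close> with multiplicity, by nondecreasing
  modulus, ties in any order. Roots are nonzero since \<open>f\<close> has a pole at \<open>z = 0\<close>.
\<close>

definition ordered_roots ::
    "nat \<Rightarrow> nat \<Rightarrow> (nat \<Rightarrow> nat \<Rightarrow> complex) \<Rightarrow> complex \<Rightarrow> (nat \<Rightarrow> complex) \<Rightarrow> bool" where
  "ordered_roots p r b x w \<longleftrightarrow>
     (\<forall>k\<le>p. w k \<noteq> 0 \<and> symbol_det p r b (w k) x = 0) \<and>
     (\<forall>u. u \<noteq> 0 \<and> symbol_det p r b u x = 0 \<longrightarrow>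
        int (card {k. k \<le> p \<and> w k = u}) = zorder (\<lambda>z. symbol_det p r b z x) u) \<and>
     (\<forall>k l. k \<le> l \<and> l \<le> p \<longrightarrow> cmod (w k) \<le> cmod (w l))"

text \<open>The exponent \<open>p(r - p)\<close> may be negative, hence the integer power.\<close>

definition lead_const :: "nat \<Rightarrow> nat \<Rightarrow> (nat \<Rightarrow> nat \<Rightarrow> complex) \<Rightarrow> complex" where
  "lead_const p r b = (-1) powi (int p * (int r - int p)) * (\<Prod>k<r. b p k)"

end

theory Submission
  imports Defs "HOL-Computational_Algebra.Field_as_Ring"
begin

text \<open>
  Multiplying the last row of the symbol by \<open>z\<close> gives a matrix with entries polynomial in \<open>z\<close>. The
  recurrence for \<open>Q\<close> says that this matrix maps the vector of generating functions
  \<open>\<Sum>\<^sub>n Q\<^sub>r\<^sub>n\<^sub>+\<^sub>j z\<^sup>n\<close> to the last unit vector, so by Cramer's rule these functions are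
  \<open>\<plusminus> det F\<^sup>r\<^sup>-\<^sup>1\<^sup>,\<^sup>j / (z f)\<close>. Since \<open>z f\<close> has degree \<open>p + 1\<close> and the minor has degree at
  most \<open>p\<close>, the formula is the partial fraction decomposition. All degree information comes from the
  substitution \<open>z = t\<^sup>r\<close>: rescaling rows and columns by powers of \<open>t\<close> makes the entries on the
  \<open>k\<close>-th cyclic diagonal homogeneous of degree \<open>k\<close> in \<open>t\<close>.

  For the finiteness, \<open>z f\<close> is irreducible as a polynomial in \<open>x\<close> over the polynomials in \<open>z\<close>: its leading
  coefficient is \<open>\<plusminus> z\<close> and its value at \<open>z = 0\<close> is \<open>\<plusminus> 1\<close>. A minor has smaller degree in \<open>x\<close> and is
  not zero, as one sees from \<open>z = t\<^sup>r\<close>, \<open>x = 2 / t\<close>, \<open>t \<longlonglongrightarrow> 0\<close>. So some nonzero polynomial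
  in \<open>z\<close> alone vanishes at all common zeros, and each \<open>z\<close> belongs to finitely many \<open>x\<close>.
\<close>

subsection \<open>Determinants of rescaled and polynomial matrices\<close>

text \<open>Coefficients are read at the bounds rather than at the actual degrees, so a drop in
  degree needs no separate treatment; for \<open>i \<noteq> m\<close> one of the two factors lies
  beyond its bound.\<close>

lemma coeff_mult_bounded:
  fixes f g :: "'a::comm_semiring_1 poly"
  assumes "degree f \<le> m" "degree g \<le> n"
  shows "coeff (f * g) (m + n) = coeff f m * coeff g n"
proof -
  have "coeff f i * coeff g (m + n - i) = 0" if "i \<le> m + n" "i \<noteq> m" for i
    using that assms by (cases "i < m") (auto simp: coeff_eq_0)
  then have "coeff (f * g) (m + n) = (\<Sum>i\<in>{m}. coeff f i * coeff g (m + n - i))"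
    unfolding coeff_mult by (intro sum.mono_neutral_right) auto
  then show ?thesis by simp
qed

lemma coeff_prod_bounded:
  fixes f :: "'b \<Rightarrow> 'a::comm_semiring_1 poly"
  assumes "finite S" "\<And>s. s \<in> S \<Longrightarrow> degree (f s) \<le> d"
  shows "degree (prod f S) \<le> card S * d \<and> coeff (prod f S) (card S * d) = (\<Prod>s\<in>S. coeff (f s) d)"
  using assms
proof (induction S)
  case (insert s S)
  then have "degree (f s * prod f S) \<le> d + card S * d"
    by (intro order.trans[OF degree_mult_le] add_mono) auto
  with insert show ?case using coeff_mult_bounded[of "f s" d "prod f S" "card S * d"] by simp
qed auto

text \<open>Each Leibniz term is a product of \<open>n\<close> entries. Applied with
  \<open>d = p + 1\<close> to polynomials in t and with \<open>d = 1\<close> to polynomials in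
  x.\<close>

lemma coeff_det_bounded:
  fixes A :: "'a::comm_ring_1 poly mat"
  assumes A: "A \<in> carrier_mat n n" and deg: "\<And>i j. i < n \<Longrightarrow> j < n \<Longrightarrow> degree (A $$ (i, j)) \<le> d"
  shows "degree (Determinant.det A) \<le> n * d"
    and "coeff (Determinant.det A) (n * d) = Determinant.det (map_mat (\<lambda>f. coeff f d) A)"
proof -
  have *: "degree (of_int (sign q) * (\<Prod>i = 0..<n. A $$ (i, q i))) \<le> n * d
      \<and> coeff (of_int (sign q) * (\<Prod>i = 0..<n. A $$ (i, q i))) (n * d)
        = of_int (sign q) * (\<Prod>i = 0..<n. coeff (A $$ (i, q i)) d)"
    if "q permutes {0..<n}" for q
  proof -
    have "degree (A $$ (i, q i)) \<le> d" if "i \<in> {0..<n}" for i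
      using deg[of i "q i"] that permutes_in_image[OF \<open>q permutes _\<close>, of i] by auto
    from coeff_prod_bounded[of "{0..<n}" "\<lambda>i. A $$ (i, q i)", OF _ this]
    have "degree (\<Prod>i = 0..<n. A $$ (i, q i)) \<le> n * d \<and>
        coeff (\<Prod>i = 0..<n. A $$ (i, q i)) (n * d) = (\<Prod>i = 0..<n. coeff (A $$ (i, q i)) d)" by simp
    then show ?thesis
      by (auto simp: sign_def)
  qed
  have perm: "finite {q. q permutes {0..<n}}" by (simp add: finite_permutations)
  show "degree (Determinant.det A) \<le> n * d"
    unfolding Determinant.det_def'[OF A] using * by (intro degree_sum_le[OF perm]) auto
  have "coeff (Determinant.det A) (n * d) =
      (\<Sum>q | q permutes {0..<n}. of_int (sign q) * (\<Prod>i = 0..<n. coeff (A $$ (i, q i)) d))"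
    unfolding Determinant.det_def'[OF A] coeff_sum using * by (intro sum.cong) auto
  also have "\<dots> = Determinant.det (map_mat (\<lambda>f. coeff f d) A)"
  proof -
    have "map_mat (\<lambda>f. coeff f d) A \<in> carrier_mat n n" using A by simp
    moreover have "q i < n" if "q permutes {0..<n}" "i < n" for q i
      using permutes_in_image[OF that(1), of i] that(2) by auto
    ultimately show ?thesis using A by (auto simp: Determinant.det_def' intro!: sum.cong prod.cong)
  qed
  finally show "coeff (Determinant.det A) (n * d) = Determinant.det (map_mat (\<lambda>f. coeff f d) A)" .
qed

lemma det_mat_diag:
  "Determinant.det (mat_diag n f) = (\<Prod>i<n. f i :: 'a::comm_ring_1)"
proof -
  have "Determinant.det (mat_diag n f) = prod_list (diag_mat (mat_diag n f))"
    by (rule det_upper_triangular[OF _ mat_diag_dim]) (auto simp: mat_diag_def)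
  then show ?thesis by (simp add: prod_list_diag_prod mat_diag_def atLeast0LessThan)
qed

text \<open>The hypothesis says diag(u) A = B diag(v). Nothing is inverted, so the scalings may lie
  in any commutative ring.\<close>

lemma det_rescale:
  fixes A B :: "'a::comm_ring_1 mat"
  assumes A: "A \<in> carrier_mat n n" and B: "B \<in> carrier_mat n n"
    and eq: "\<And>i j. i < n \<Longrightarrow> j < n \<Longrightarrow> u i * A $$ (i, j) = v j * B $$ (i, j)"
  shows "(\<Prod>i<n. u i) * Determinant.det A = (\<Prod>j<n. v j) * Determinant.det B"
proof -
  have "mat_diag n u * A = B * mat_diag n v"
    unfolding mat_diag_mult_left[OF A] mat_diag_mult_right[OF B]
    by (rule cong_mat) (auto simp: eq mult.commute)
  then have "Determinant.det (mat_diag n u * A) = Determinant.det (B * mat_diag n v)" by simp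
  then show ?thesis
    using A B by (simp add: Determinant.det_mult[OF mat_diag_dim A]
        Determinant.det_mult[OF B mat_diag_dim] det_mat_diag mult.commute)
qed

lemma mat_delete_nth:
  assumes "A \<in> carrier_mat n n" "i < n" "j < n" "i' < n - 1" "j' < n - 1"
  shows "mat_delete A i j $$ (i', j') = A $$ (insert_index i i', insert_index j j')"
  using assms mat_delete_index[of A "n - 1" i j i' j'] by (cases n) auto

lemma insert_index_less: "i < n \<Longrightarrow> i' < n - 1 \<Longrightarrow> insert_index i i' < n"
  by (auto simp: insert_index_def)

lemma prod_insert_index:
  assumes "i < n"
  shows "(\<Prod>l<n - 1. u (insert_index i l)) = prod u ({..<n} - {i})"
proof -
  have "prod u (insert_index i ` {0..<n - 1}) = (\<Prod>l = 0..<n - 1. u (insert_index i l))"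
    by (simp add: prod.reindex insert_index_inj_on)
  then show ?thesis using insert_index_image[of i "n - 1"] assms by (simp add: atLeast0LessThan)
qed

text \<open>The deleted row and column take their factors \<open>u i\<close> and \<open>v j\<close>
  with them.\<close>

lemma minor_rescale:
  fixes A B :: "'a::comm_ring_1 mat"
  assumes A: "A \<in> carrier_mat n n" and B: "B \<in> carrier_mat n n"
    and eq: "\<And>i j. i < n \<Longrightarrow> j < n \<Longrightarrow> u i * A $$ (i, j) = v j * B $$ (i, j)"
    and ij: "i < n" "j < n"
  shows "prod u ({..<n} - {i}) * Determinant.det (mat_delete A i j)
       = prod v ({..<n} - {j}) * Determinant.det (mat_delete B i j)"
proof -
  have "(\<Prod>l<n - 1. u (insert_index i l)) * Determinant.det (mat_delete A i j)
      = (\<Prod>l<n - 1. v (insert_index j l)) * Determinant.det (mat_delete B i j)"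
    using ij by (intro det_rescale mat_delete_carrier A B)
      (simp add: mat_delete_nth[OF A ij] mat_delete_nth[OF B ij] eq insert_index_less)
  then show ?thesis unfolding prod_insert_index[OF ij(1)] prod_insert_index[OF ij(2)] .
qed

lemma (in comm_ring_hom) hom_minor:
  assumes A: "A \<in> carrier_mat n n" and "i < n" "j < n"
  shows "Determinant.det (mat_delete (map_mat hom A) i j) = hom (Determinant.det (mat_delete A i j))"
proof -
  have "mat_delete (map_mat hom A) i j = map_mat hom (mat_delete A i j)"
    using assms by (intro eq_matI) (auto simp: mat_delete_def)
  then show ?thesis by (simp only: hom_det)
qed

subsection \<open>Cyclic banded matrices and the symbol\<close>

text \<open>
  The row index is shifted by one because the lowest diagonal of the symbol is the one of \<open>Z\<^sup>-\<^sup>1\<close>: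
  the coefficient of \<open>Z\<^sup>k\<^sup>-\<^sup>1\<close> is \<open>c k\<close>, with \<open>k \<ge> 0\<close>.
\<close>

definition wrap_mat :: "nat \<Rightarrow> nat \<Rightarrow> (nat \<Rightarrow> nat \<Rightarrow> 'a::comm_ring_1) \<Rightarrow> 'a mat" where
  "wrap_mat r m c = Matrix.mat r r
     (\<lambda>(i, j). \<Sum>k\<le>m. if (j + k) mod r = (i + 1) mod r then c k j else 0)"

lemma wrap_mat_carrier [simp]: "wrap_mat r m c \<in> carrier_mat r r"
  by (simp add: wrap_mat_def)

lemma wrap_mat_nth:
  "i < r \<Longrightarrow> j < r \<Longrightarrow>
    wrap_mat r m c $$ (i, j) = (\<Sum>k\<le>m. if (j + k) mod r = (i + 1) mod r then c k j else 0)"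
  by (simp add: wrap_mat_def)

lemma wrap_mat_cong:
  assumes "\<And>k j. k \<le> m \<Longrightarrow> j < r \<Longrightarrow> c k j = c' k j"
  shows "wrap_mat r m c = wrap_mat r m c'"
  unfolding wrap_mat_def by (rule cong_mat) (auto intro!: sum.cong simp: assms)

lemma (in comm_ring_hom) hom_wrap_mat:
  "map_mat hom (wrap_mat r m c) = wrap_mat r m (\<lambda>k j. hom (c k j))"
  by (rule eq_matI) (auto simp: wrap_mat_def hom_sum intro!: sum.cong)

lemma bij_betw_Suc_mod: "bij_betw (\<lambda>i. (i + 1) mod r) {..<r} {..<r::nat}"
proof -
  have inj: "inj_on (\<lambda>i. (i + 1) mod r) {..<r}"
    by (auto simp: inj_on_def mod_Suc split: if_splits)
  moreover have "(\<lambda>i. (i + 1) mod r) ` {..<r} \<subseteq> {..<r}" by auto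
  ultimately show ?thesis by (simp add: bij_betw_def endo_inj_surj)
qed

lemma prod_power_Suc_mod:
  "(\<Prod>i<r. (t::'a::comm_monoid_mult) ^ ((i + 1) mod r)) = (\<Prod>j<r. t ^ j)"
  using prod.reindex_bij_betw[OF bij_betw_Suc_mod, of "\<lambda>i. t ^ i" r] by simp

text \<open>On the k-th cyclic diagonal the row factor has exponent \<open>(j + k) mod r\<close>,
  and \<open>r * ((j + k) div r) + (j + k) mod r = j + k\<close>. So the powers of z = t^r turn into
  \<open>t ^ k\<close>, up to the column factor.\<close>

lemma wrap_mat_rescale_nth:
  fixes t :: "'a::comm_ring_1"
  assumes "i < r" "j < r"
  shows "t ^ ((i + 1) mod r) * wrap_mat r m (\<lambda>k j. c k j * (t ^ r) ^ ((j + k) div r)) $$ (i, j)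
       = t ^ j * wrap_mat r m (\<lambda>k j. c k j * t ^ k) $$ (i, j)"
proof -
  have "t ^ ((j + k) mod r) * (t ^ r) ^ ((j + k) div r) = t ^ j * t ^ k" for k
    by (simp flip: power_mult power_add)
  then have pow: "t ^ ((j + k) mod r) * (c k j * (t ^ r) ^ ((j + k) div r)) = t ^ j * (c k j * t ^ k)" for k
    by (simp only: mult.left_commute[of _ "c k j"])
  have "t ^ ((i + 1) mod r) * (if (j + k) mod r = (i + 1) mod r then c k j * (t ^ r) ^ ((j + k) div r) else 0)
     = t ^ j * (if (j + k) mod r = (i + 1) mod r then c k j * t ^ k else 0)" for k
    using pow[of k] by (cases "(j + k) mod r = (i + 1) mod r") (simp_all only: if_True if_False mult_zero_right refl)
  then show ?thesis
    using assms by (simp add: wrap_mat_nth sum_distrib_left)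
qed

text \<open>The exponents \<open>(i + 1) mod r\<close> of the row factors are a permutation of those
  of the column factors, so the two products agree and cancel.\<close>

lemma det_wrap_mat_rescale:
  fixes t :: "'a::idom"
  assumes "t \<noteq> 0"
  shows "Determinant.det (wrap_mat r m (\<lambda>k j. c k j * (t ^ r) ^ ((j + k) div r)))
       = Determinant.det (wrap_mat r m (\<lambda>k j. c k j * t ^ k))"
  using det_rescale[OF wrap_mat_carrier wrap_mat_carrier wrap_mat_rescale_nth, of r t m c] assms
  unfolding prod_power_Suc_mod by simp

lemma minor_wrap_mat_rescale:
  fixes t :: "'a::idom"
  assumes "t \<noteq> 0" and ij: "i < r" "j < r"
  shows "t ^ j * Determinant.det (mat_delete (wrap_mat r m (\<lambda>k j. c k j * (t ^ r) ^ ((j + k) div r))) i j)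
       = t ^ ((i + 1) mod r) * Determinant.det (mat_delete (wrap_mat r m (\<lambda>k j. c k j * t ^ k)) i j)"
    (is "t ^ j * ?D = _ * ?E")
proof -
  let ?u = "\<lambda>i. t ^ ((i + 1) mod r)" and ?v = "\<lambda>j. t ^ j"
  have "prod ?u ({..<r} - {i}) * ?D = prod ?v ({..<r} - {j}) * ?E"
    by (rule minor_rescale[OF wrap_mat_carrier wrap_mat_carrier wrap_mat_rescale_nth ij])
  \<comment> \<open>Putting back the factors of the deleted row and column makes both products full
    ones, and these coincide.\<close>
  then have "(?u i * prod ?u ({..<r} - {i})) * (?v j * ?D)
           = (?v j * prod ?v ({..<r} - {j})) * (?u i * ?E)"
    by (simp add: mult.assoc mult.left_commute)
  moreover have "?u i * prod ?u ({..<r} - {i}) = prod ?u {..<r}"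
    using ij by (simp add: prod.remove[of _ i])
  moreover have "?v j * prod ?v ({..<r} - {j}) = prod ?v {..<r}"
    using ij by (simp add: prod.remove[of _ j])
  ultimately have "prod ?v {..<r} * (?v j * ?D) = prod ?v {..<r} * (?u i * ?E)"
    by (simp only: prod_power_Suc_mod)
  moreover have "prod ?v {..<r} \<noteq> 0" using \<open>t \<noteq> 0\<close> by simp
  ultimately show ?thesis using mult_left_cancel by blast
qed

section \<open>Entries of the symbol and of its pole-free form\<close>

lemma cyclic_shift_carrier [simp]: "cyclic_shift r z \<in> carrier_mat r r"
  by (simp add: cyclic_shift_def)

lemma cyclic_shift_nth:
  assumes "i < r" "j < r"
  shows "cyclic_shift r z $$ (i, j) = (if i = (j + 1) mod r then z ^ ((j + 1) div r) else 0)"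
  using assms by (cases "j = r - 1") (auto simp: cyclic_shift_def)

text \<open>Index j moves k places around the cycle, and \<open>(j + k) div r\<close> counts how
  often it passes the entry z.\<close>

lemma cyclic_shift_pow_nth:
  assumes "i < r" "j < r"
  shows "(cyclic_shift r z ^\<^sub>m k) $$ (i, j) = (if i = (j + k) mod r then z ^ ((j + k) div r) else 0)"
  using assms
proof (induction k arbitrary: i j)
  case (Suc k)
  let ?Z = "cyclic_shift r z"
  have pow: "?Z ^\<^sub>m k \<in> carrier_mat r r" by (simp add: pow_carrier_mat)
  have "(?Z ^\<^sub>m Suc k) $$ (i, j) = (\<Sum>l<r. (?Z ^\<^sub>m k) $$ (i, l) * ?Z $$ (l, j))"
    using Suc.prems pow carrier_matD[OF cyclic_shift_carrier[of r z]]
    by (simp add: scalar_prod_def lessThan_atLeast0)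
  also have "\<dots> = (\<Sum>l<r. if l = (j + 1) mod r then (?Z ^\<^sub>m k) $$ (i, l) * z ^ ((j + 1) div r) else 0)"
    using Suc.prems by (intro sum.cong) (auto simp: cyclic_shift_nth)
  also have "\<dots> = (?Z ^\<^sub>m k) $$ (i, (j + 1) mod r) * z ^ ((j + 1) div r)"
    using Suc.prems by (subst sum.delta) auto
  also have "\<dots> = (if i = (j + Suc k) mod r
      then z ^ (((j + 1) mod r + k) div r + (j + 1) div r) else 0)"
  proof -
    have 1: "(j + 1) mod r < r" using Suc.prems by simp
    have 2: "((j + 1) mod r + k) mod r = (j + Suc k) mod r"
      using mod_add_left_eq[of "j + 1" r k] by (simp only: add_Suc_right add_Suc add_0_right One_nat_def)
    show ?thesis
      unfolding Suc.IH[OF Suc.prems(1) 1] 2 power_add by (cases "i = (j + Suc k) mod r") simp_all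
  qed
  \<comment> \<open>The passes made by the first step and by the remaining \<open>k\<close> steps
    add up.\<close>
  also have "((j + 1) mod r + k) div r + (j + 1) div r = (j + Suc k) div r"
  proof -
    have "j + Suc k = ((j + 1) mod r + k) + (j + 1) div r * r"
      using div_mult_mod_eq[of "j + 1" r] by linarith
    moreover have "r \<noteq> 0" using Suc.prems by auto
    ultimately show ?thesis using div_mult_self1[of r "(j + 1) mod r + k" "(j + 1) div r"] by simp
  qed
  finally show ?case .
next
  case 0
  have "dim_row (cyclic_shift r z) = r" by (simp add: cyclic_shift_def)
  with 0 show ?case by simp
qed

text \<open>The diagonal factor of Z^(k-1) in the symbol, with x absorbed into the main diagonal at
  \<open>k = 1\<close>. The same numbers are the coefficients of the recurrence for Q.\<close>

definition symbol_coeff :: "(nat \<Rightarrow> nat \<Rightarrow> 'a::comm_ring_1) \<Rightarrow> 'a \<Rightarrow> nat \<Rightarrow> nat \<Rightarrow> 'a" where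
  "symbol_coeff b x k j = (if k = 0 then 1 else b (k - 1) j - (if k = 1 then x else 0))"

text \<open>
  The symbol with its last row multiplied by \<open>z\<close>, which removes the only pole; defined over any
  ring, so that \<open>z\<close> and \<open>x\<close> can be indeterminates.
\<close>

definition cleared_symbol ::
    "nat \<Rightarrow> nat \<Rightarrow> (nat \<Rightarrow> nat \<Rightarrow> 'a::comm_ring_1) \<Rightarrow> 'a \<Rightarrow> 'a \<Rightarrow> 'a mat" where
  "cleared_symbol p r b x z =
     wrap_mat r (p + 1) (\<lambda>k j. symbol_coeff b x k j * z ^ ((j + k) div r))"

lemma cleared_symbol_carrier [simp]: "cleared_symbol p r b x z \<in> carrier_mat r r"
  by (simp add: cleared_symbol_def)

lemma (in comm_ring_hom) hom_symbol_coeff: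
  "hom (symbol_coeff b x k j) = symbol_coeff (\<lambda>k j. hom (b k j)) (hom x) k j"
  by (simp add: symbol_coeff_def hom_minus)

lemma (in comm_ring_hom) hom_cleared_symbol:
  "map_mat hom (cleared_symbol p r b x z) = cleared_symbol p r (\<lambda>k j. hom (b k j)) (hom x) (hom z)"
  by (simp add: cleared_symbol_def hom_wrap_mat hom_mult hom_power hom_symbol_coeff)

lemma Suc_mod_eq_iff:
  fixes i j r :: nat
  assumes "i < r"
  shows "(j + 1) mod r = (i + 1) mod r \<longleftrightarrow> j mod r = i"
proof -
  have "(j + 1) mod r = (j mod r + 1) mod r" by (rule mod_add_left_eq[symmetric])
  then show ?thesis
    using inj_on_eq_iff[OF bij_betw_imp_inj_on[OF bij_betw_Suc_mod], of "j mod r" r i] assms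
    by (simp only: lessThan_iff mod_less_divisor gr_implies_not0)
qed

lemma symbol_carrier: "symbol p r b z x \<in> carrier_mat r r"
  by (auto simp: symbol_def)

lemma symbol_nth:
  assumes "r \<ge> 1" "z \<noteq> 0" and ij: "i < r" "j < r"
  shows "symbol p r b z x $$ (i, j) =
      (if j = i + 1 then 1 else if i = r - 1 \<and> j = 0 then 1 / z else 0)
      + (\<Sum>k\<le>p. if (j + k) mod r = i then b k j * z ^ ((j + k) div r) else 0)
      - (if i = j then x else 0)"
proof -
  have pow: "cyclic_shift r z ^\<^sub>m k \<in> carrier_mat r r" for k by (simp add: pow_carrier_mat)
  have "((cyclic_shift r z ^\<^sub>m k) * mat_diag r (b k)) $$ (i, j)
      = (if (j + k) mod r = i then b k j * z ^ ((j + k) div r) else 0)" for k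
    unfolding mat_diag_mult_right[OF pow] using ij by (auto simp: cyclic_shift_pow_nth)
  then show ?thesis
    unfolding symbol_def cyclic_shift_inverse[OF assms(1,2)] using ij by simp
qed

text \<open>Raising k by one moves the residue from i to i + 1 and adds a pass through z exactly
  when i = r - 1. This is the factor z of the last row.\<close>

lemma cleared_symbol_nth:
  assumes "r \<ge> 1" "z \<noteq> 0" and ij: "i < r" "j < r"
  shows "(if i = r - 1 then z else 1) * symbol p r b z x $$ (i, j) = cleared_symbol p r b x z $$ (i, j)"
proof -
  let ?e = "if i = r - 1 then z else 1 :: complex"
  define s where "s k = (if (j + k) mod r = i then (b k j - (if k = 0 then x else 0)) * z ^ ((j + k) div r) else 0)" for k
  define S where "S = (\<Sum>k\<le>p. if (j + k) mod r = i then b k j * z ^ ((j + k) div r) else 0)"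
  have *: "(if (j + Suc k) mod r = (i + 1) mod r
        then symbol_coeff b x (Suc k) j * z ^ ((j + Suc k) div r) else 0) = ?e * s k" for k
  proof (cases "(j + k) mod r = i")
    case True
    have "(j + Suc k) div r = (j + k) div r + (if i = r - 1 then 1 else 0)"
      using True \<open>r \<ge> 1\<close> by (auto simp: div_Suc mod_Suc)
    then show ?thesis
      using True Suc_mod_eq_iff[OF ij(1), of "j + k"] by (auto simp: s_def symbol_coeff_def)
  next
    case False
    then show ?thesis using Suc_mod_eq_iff[OF ij(1), of "j + k"] by (auto simp: s_def)
  qed
  have "cleared_symbol p r b x z $$ (i, j)
      = (if j = (i + 1) mod r then 1 else 0) + (\<Sum>k\<le>p. ?e * s k)"
  proof -
    \<comment> \<open>The summand \<open>k = 0\<close> comes from Z^-1; since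
      \<open>j div r = 0\<close>, it carries no power of z.\<close>
    have "(if (j + 0) mod r = (i + 1) mod r then symbol_coeff b x 0 j * z ^ ((j + 0) div r) else 0)
        = (if j = (i + 1) mod r then 1 else 0)"
      using ij by (simp add: symbol_coeff_def)
    then show ?thesis
      unfolding cleared_symbol_def wrap_mat_nth[OF ij] Suc_eq_plus1[of p, symmetric] sum.atMost_Suc_shift
      by (simp only: Suc_eq_plus1[of i] *)
  qed
  also have "(\<Sum>k\<le>p. ?e * s k) = ?e * (\<Sum>k\<le>p. s k)" by (simp add: sum_distrib_left)
  also have "(\<Sum>k\<le>p. s k) = (\<Sum>k\<le>p. if (j + k) mod r = i then b k j * z ^ ((j + k) div r) else 0)
      - (\<Sum>k\<le>p. if k = 0 then (if i = j then x else 0) else 0)"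
  proof -
    have "s k = (if (j + k) mod r = i then b k j * z ^ ((j + k) div r) else 0)
        - (if k = 0 then (if i = j then x else 0) else 0)" for k
      using ij by (cases "k = 0"; cases "(j + k) mod r = i") (simp_all add: s_def left_diff_distrib)
    then show ?thesis by (simp only: sum_subtractf)
  qed
  finally have eq: "cleared_symbol p r b x z $$ (i, j)
      = (if j = (i + 1) mod r then 1 else 0) + ?e * (S - (\<Sum>k\<le>p. if k = 0 then (if i = j then x else 0) else 0))"
    unfolding S_def .
  have "(\<Sum>k\<le>p. if k = 0 then (if i = j then x else 0) else 0) = (if i = j then x else 0)"
    by (subst sum.delta) auto
  note eq = eq[unfolded this]
  have "symbol p r b z x $$ (i, j) =
      (if j = i + 1 then 1 else if i = r - 1 \<and> j = 0 then 1 / z else 0) + S - (if i = j then x else 0)"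
    unfolding S_def by (rule symbol_nth[OF assms])
  then show ?thesis
  proof (cases "i = r - 1")
    case True
    then have "(i + 1) mod r = 0" "j \<noteq> i + 1" using ij by auto
    \<comment> \<open>In the corner \<open>j = 0\<close> the entry 1/z of Z^-1 becomes 1.\<close>
    then show ?thesis unfolding eq \<open>symbol p r b z x $$ (i, j) = _\<close>
      using True \<open>z \<noteq> 0\<close> by (cases "j = 0") (simp_all add: distrib_left right_diff_distrib)
  next
    case False
    then have "(i + 1) mod r = i + 1" using ij by auto
    then show ?thesis unfolding eq \<open>symbol p r b z x $$ (i, j) = _\<close>
      using False by simp
  qed
qed

lemma det_cleared_symbol:
  assumes "r \<ge> 1" "z \<noteq> 0"
  shows "Determinant.det (cleared_symbol p r b x z) = z * symbol_det p r b z x"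
proof -
  have "(\<Prod>i<r. if i = r - 1 then z else 1) * symbol_det p r b z x
      = (\<Prod>i<r. 1) * Determinant.det (cleared_symbol p r b x z)"
    unfolding symbol_det_def
    by (rule det_rescale[OF symbol_carrier cleared_symbol_carrier])
      (simp only: cleared_symbol_nth[OF assms] mult_1)
  moreover have "(\<Prod>i<r. if i = r - 1 then z else 1) = z"
    using \<open>r \<ge> 1\<close> by (subst prod.delta) auto
  ultimately show ?thesis by simp
qed

text \<open>The factor z sits in the last row, so it disappears when that row is the deleted
  one.\<close>

lemma minor_cleared_symbol:
  assumes "r \<ge> 1" "z \<noteq> 0" and ij: "i < r" "j < r"
  shows "Determinant.det (mat_delete (cleared_symbol p r b x z) i j)
       = (if i = r - 1 then 1 else z) * symbol_minor p r b i j z x"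
proof -
  have "(\<Prod>l\<in>{..<r} - {i}. if l = r - 1 then z else 1) * symbol_minor p r b i j z x
      = (\<Prod>l\<in>{..<r} - {j}. 1) * Determinant.det (mat_delete (cleared_symbol p r b x z) i j)"
    unfolding symbol_minor_def
    by (rule minor_rescale[OF symbol_carrier cleared_symbol_carrier _ ij])
      (simp only: cleared_symbol_nth[OF assms(1,2)] mult_1)
  moreover have "(\<Prod>l\<in>{..<r} - {i}. if l = r - 1 then z else 1) = (if i = r - 1 then 1 else z)"
    using ij by (subst prod.delta) auto
  ultimately show ?thesis by simp
qed

subsection \<open>Degree of the symbol determinant and its minors\<close>

text \<open>In the first row only the last entry can be nonzero, and deleting its row and column
  leaves an identity matrix.\<close>

lemma det_cyclic_shift:
  assumes "r \<ge> 1"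
  shows "Determinant.det (cyclic_shift r z) = (-1) ^ (r - 1) * z"
proof -
  let ?Z = "cyclic_shift r z"
  have "mat_delete ?Z 0 (r - 1) = 1\<^sub>m (r - 1)"
    using assms by (intro eq_matI) (auto simp: mat_delete_def cyclic_shift_def)
  then have "cofactor ?Z 0 (r - 1) = (-1) ^ (r - 1)" by (simp add: cofactor_def)
  moreover have "Determinant.det ?Z = (\<Sum>j<r. ?Z $$ (0, j) * cofactor ?Z 0 j)"
    using assms by (intro laplace_expansion_row cyclic_shift_carrier) auto
  moreover have "\<dots> = (\<Sum>j<r. if j = r - 1 then z * cofactor ?Z 0 j else 0)"
    using assms by (intro sum.cong) (auto simp: cyclic_shift_def)
  ultimately show ?thesis using assms by (simp add: sum.delta)
qed

text \<open>This matrix is the inverse cyclic shift at z = 1, the transpose of a permutation matrix;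
  it is what remains of the graded symbol at t = 0.\<close>

lemma det_wrap_mat_superdiagonal:
  assumes "r \<ge> 1"
  shows "Determinant.det (wrap_mat r m (\<lambda>k j. if k = 0 then 1 else 0 :: complex)) = (-1) ^ (r - 1)"
proof -
  have "wrap_mat r m (\<lambda>k j. if k = 0 then 1 else 0) = transpose_mat (cyclic_shift r 1)"
  proof (rule eq_matI)
    fix i j assume "i < dim_row (transpose_mat (cyclic_shift r 1))" "j < dim_col (transpose_mat (cyclic_shift r 1))"
    then have ij: "i < r" "j < r" by (auto simp: cyclic_shift_def)
    have "wrap_mat r m (\<lambda>k j. if k = 0 then 1 else 0 :: complex) $$ (i, j)
        = (\<Sum>k\<le>m. if k = 0 then (if j = (i + 1) mod r then 1 else 0) else 0)"
      unfolding wrap_mat_nth[OF ij] using ij by (intro sum.cong) auto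
    also have "\<dots> = (if j = (i + 1) mod r then 1 else 0)" by (subst sum.delta) auto
    also have "\<dots> = transpose_mat (cyclic_shift r 1) $$ (i, j)"
      using ij cyclic_shift_nth[OF ij(2,1), of 1] carrier_matD[OF cyclic_shift_carrier[of r 1]] by simp
    finally show "wrap_mat r m (\<lambda>k j. if k = 0 then 1 else 0) $$ (i, j) = transpose_mat (cyclic_shift r 1) $$ (i, j)" .
  qed (auto simp: wrap_mat_def cyclic_shift_def)
  then show ?thesis
    using det_cyclic_shift[OF assms, of 1] Determinant.det_transpose[OF cyclic_shift_carrier[of r 1]] by simp
qed

lemma det_pow_mat:
  fixes A :: "'a::comm_ring_1 mat"
  assumes "A \<in> carrier_mat n n"
  shows "Determinant.det (A ^\<^sub>m k) = Determinant.det A ^ k"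
proof (induction k)
  case 0
  then show ?case using assms by simp
next
  case (Suc k)
  then show ?case using assms Determinant.det_mult[OF pow_carrier_mat[OF assms, of k] assms] by simp
qed

text \<open>Only the parity of the exponent matters, and p(r - p) and (r - 1)p agree modulo 2
  because p^2 and p do.\<close>

lemma lead_const_eq:
  assumes "r \<ge> 1"
  shows "lead_const p r b = ((-1) ^ (r - 1)) ^ p * (\<Prod>k<r. b p k)"
proof -
  have "even (int p * (int r - int p)) \<longleftrightarrow> even ((r - 1) * p)"
    using assms by (auto simp: even_diff_nat)
  then have "(-1 :: complex) powi (int p * (int r - int p)) = (-1) ^ ((r - 1) * p)"
    by (auto simp: power_int_minus_left minus_one_power_iff)
  then show ?thesis by (simp add: lead_const_def power_mult)
qed

text \<open>The diagonal \<open>k = p + 1\<close> alone is Z^p diag(b^(p)) at z = 1, and the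
  determinant is multiplicative.\<close>

lemma det_wrap_mat_top:
  assumes "r \<ge> 1"
  shows "Determinant.det (wrap_mat r (p + 1) (\<lambda>k j. if k = p + 1 then b p j else 0)) = lead_const p r b"
proof -
  have pow: "cyclic_shift r 1 ^\<^sub>m p \<in> carrier_mat r r" by (simp add: pow_carrier_mat)
  have "wrap_mat r (p + 1) (\<lambda>k j. if k = p + 1 then b p j else 0)
      = (cyclic_shift r 1 ^\<^sub>m p) * mat_diag r (b p)"
  proof (rule eq_matI)
    fix i j assume "i < dim_row ((cyclic_shift r 1 ^\<^sub>m p) * mat_diag r (b p))"
      "j < dim_col ((cyclic_shift r 1 ^\<^sub>m p) * mat_diag r (b p))"
    then have ij: "i < r" "j < r"
      using carrier_matD[OF cyclic_shift_carrier[of r 1]] by (auto simp: mat_diag_def)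
    have "(j + (p + 1)) mod r = (i + 1) mod r \<longleftrightarrow> (j + p) mod r = i"
      using Suc_mod_eq_iff[OF ij(1), of "j + p"] by (simp only: add.assoc)
    then have "wrap_mat r (p + 1) (\<lambda>k j. if k = p + 1 then b p j else 0) $$ (i, j)
        = (\<Sum>k\<le>p + 1. if k = p + 1 then (if (j + p) mod r = i then b p j else 0) else 0)"
      unfolding wrap_mat_nth[OF ij] by (intro sum.cong) auto
    also have "\<dots> = (if (j + p) mod r = i then b p j else 0)" by (subst sum.delta) auto
    also have "\<dots> = ((cyclic_shift r 1 ^\<^sub>m p) * mat_diag r (b p)) $$ (i, j)"
      unfolding mat_diag_mult_right[OF pow] using ij by (auto simp: cyclic_shift_pow_nth)
    finally show "wrap_mat r (p + 1) (\<lambda>k j. if k = p + 1 then b p j else 0) $$ (i, j)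
        = ((cyclic_shift r 1 ^\<^sub>m p) * mat_diag r (b p)) $$ (i, j)" .
  qed (use carrier_matD[OF pow] in \<open>auto simp: wrap_mat_def mat_diag_def\<close>)
  then show ?thesis
    by (simp add: Determinant.det_mult[OF pow mat_diag_dim] det_pow_mat[OF cyclic_shift_carrier]
        det_cyclic_shift[OF assms] det_mat_diag lead_const_eq[OF assms])
qed

section \<open>The symbol as a polynomial matrix in z and the substitution z = t^r\<close>

lemma comm_ring_hom_poly: "comm_ring_hom (\<lambda>q. poly q (z::'a::comm_ring_1))"
  by unfold_locales auto

lemma comm_ring_hom_pcompose: "comm_ring_hom (\<lambda>q. pcompose q (s::'a::comm_ring_1 poly))"
  by unfold_locales (auto simp: pcompose_add pcompose_mult pcompose_1)

definition symbol_poly :: "nat \<Rightarrow> nat \<Rightarrow> (nat \<Rightarrow> nat \<Rightarrow> complex) \<Rightarrow> complex \<Rightarrow> complex poly mat" where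
  "symbol_poly p r b x = cleared_symbol p r (\<lambda>k j. [:b k j:]) [:x:] [:0, 1:]"

lemma symbol_poly_carrier [simp]: "symbol_poly p r b x \<in> carrier_mat r r"
  by (simp add: symbol_poly_def)

lemma poly_symbol_poly: "map_mat (\<lambda>q. poly q z) (symbol_poly p r b x) = cleared_symbol p r b x z"
  unfolding symbol_poly_def comm_ring_hom.hom_cleared_symbol[OF comm_ring_hom_poly] by simp

lemma poly_det_symbol_poly:
  "poly (Determinant.det (symbol_poly p r b x)) z = Determinant.det (cleared_symbol p r b x z)"
  using comm_ring_hom.hom_det[OF comm_ring_hom_poly, of z "symbol_poly p r b x"]
  by (simp add: poly_symbol_poly)

lemma poly_minor_symbol_poly:
  "i < r \<Longrightarrow> j < r \<Longrightarrow> poly (Determinant.det (mat_delete (symbol_poly p r b x) i j)) z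
    = Determinant.det (mat_delete (cleared_symbol p r b x z) i j)"
  using comm_ring_hom.hom_minor[OF comm_ring_hom_poly symbol_poly_carrier]
  by (simp add: poly_symbol_poly)

text \<open>The indeterminate of \<open>graded_symbol\<close> is \<open>t\<close> with \<open>t\<^sup>r = z\<close>.\<close>

definition graded_symbol :: "nat \<Rightarrow> nat \<Rightarrow> (nat \<Rightarrow> nat \<Rightarrow> complex) \<Rightarrow> complex \<Rightarrow> complex poly mat" where
  "graded_symbol p r b x = wrap_mat r (p + 1) (\<lambda>k j. monom (symbol_coeff b x k j) k)"

lemma graded_symbol_carrier [simp]: "graded_symbol p r b x \<in> carrier_mat r r"
  by (simp add: graded_symbol_def)

lemma symbol_coeff_const:
  "symbol_coeff (\<lambda>k j. [:b k j:]) [:x:] k j = [:symbol_coeff b x k j:]"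
  by (simp add: symbol_coeff_def)

lemma graded_symbol_altdef:
  "graded_symbol p r b x = wrap_mat r (p + 1) (\<lambda>k j. symbol_coeff (\<lambda>k j. [:b k j:]) [:x:] k j * [:0, 1:] ^ k)"
  unfolding graded_symbol_def symbol_coeff_const monom_altdef by simp

lemma pcompose_symbol_poly:
  "map_mat (\<lambda>q. pcompose q ([:0, 1:] ^ r)) (symbol_poly p r b x) =
    wrap_mat r (p + 1) (\<lambda>k j. symbol_coeff (\<lambda>k j. [:b k j:]) [:x:] k j * ([:0, 1:] ^ r) ^ ((j + k) div r))"
proof -
  have "pcompose [:0, 1:] s = s" for s :: "complex poly" by (simp add: pcompose_pCons)
  then show ?thesis
    unfolding symbol_poly_def comm_ring_hom.hom_cleared_symbol[OF comm_ring_hom_pcompose]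
    by (simp only: cleared_symbol_def pcompose_const)
qed

text \<open>The rescaling is used with the indeterminate itself as t, which is nonzero and can be
  cancelled. As an identity of polynomials the result may then be evaluated at t = 0 too.\<close>

lemma pcompose_det_symbol_poly:
  "pcompose (Determinant.det (symbol_poly p r b x)) ([:0, 1:] ^ r) = Determinant.det (graded_symbol p r b x)"
  using det_wrap_mat_rescale[of "[:0, 1 :: complex:]" r "p + 1" "symbol_coeff (\<lambda>k j. [:b k j:]) [:x:]"]
    comm_ring_hom.hom_det[OF comm_ring_hom_pcompose, of "[:0, 1:] ^ r" "symbol_poly p r b x"]
  unfolding graded_symbol_altdef pcompose_symbol_poly by simp

lemma pcompose_minor_symbol_poly:
  assumes ij: "i < r" "j < r"
  shows "[:0, 1:] ^ j * pcompose (Determinant.det (mat_delete (symbol_poly p r b x) i j)) ([:0, 1:] ^ r)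
      = [:0, 1:] ^ ((i + 1) mod r) * Determinant.det (mat_delete (graded_symbol p r b x) i j)"
  using minor_wrap_mat_rescale[of "[:0, 1 :: complex:]" i r j "p + 1" "symbol_coeff (\<lambda>k j. [:b k j:]) [:x:]"] ij
    comm_ring_hom.hom_minor[OF comm_ring_hom_pcompose symbol_poly_carrier ij, of "[:0, 1:] ^ r" p b x]
  unfolding graded_symbol_altdef pcompose_symbol_poly by simp

lemma degree_graded_symbol_nth:
  assumes "i < r" "j < r"
  shows "degree (graded_symbol p r b x $$ (i, j)) \<le> p + 1"
  unfolding graded_symbol_def wrap_mat_nth[OF assms]
proof (rule degree_sum_le)
  fix k assume "k \<in> {..p + 1}"
  then show "degree (if (j + k) mod r = (i + 1) mod r then monom (symbol_coeff b x k j) k else 0) \<le> p + 1"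
    using degree_monom_le[of "symbol_coeff b x k j" k] by simp
qed simp

text \<open>\<open>p \<ge> 1\<close> separates the top diagonal \<open>k = p + 1\<close> from
  \<open>k = 1\<close>, which carries x; hence the leading coefficients are free of x.\<close>

lemma coeff_graded_symbol:
  assumes "p \<ge> 1"
  shows "map_mat (\<lambda>q. coeff q (p + 1)) (graded_symbol p r b x)
       = wrap_mat r (p + 1) (\<lambda>k j. if k = p + 1 then b p j else 0)"
  by (rule eq_matI)
    (use assms in \<open>auto simp: graded_symbol_def wrap_mat_def coeff_sum symbol_coeff_def intro!: sum.cong\<close>)

lemma degree_X_power: "degree ([:0, 1 :: 'a::idom:] ^ n) = n"
  by (simp add: degree_power_eq)

text \<open>Composition with t^r multiplies degrees by r, so the bound r(p + 1) for the graded
  determinant becomes p + 1, and the coefficient there at r(p + 1) is the one here at p + 1.\<close>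

lemma det_symbol_poly_top:
  assumes "p \<ge> 1" "r \<ge> 1"
  shows "degree (Determinant.det (symbol_poly p r b x)) \<le> p + 1" (is "degree ?P \<le> _")
    and "coeff (Determinant.det (symbol_poly p r b x)) (p + 1) = lead_const p r b"
proof -
  let ?T = "[:0, 1 :: complex:] ^ r"
  have top: "degree (Determinant.det (graded_symbol p r b x)) \<le> r * (p + 1)"
    "coeff (Determinant.det (graded_symbol p r b x)) (r * (p + 1))
      = Determinant.det (map_mat (\<lambda>q. coeff q (p + 1)) (graded_symbol p r b x))"
    by (rule coeff_det_bounded[OF graded_symbol_carrier degree_graded_symbol_nth]; assumption)+
  have deg: "degree (pcompose ?P ?T) = degree ?P * r" by (simp only: degree_pcompose degree_X_power)
  with top(1) have "degree ?P * r \<le> (p + 1) * r"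
    by (simp only: pcompose_det_symbol_poly mult.commute)
  then show le: "degree ?P \<le> p + 1" using \<open>r \<ge> 1\<close> by (simp only: mult_le_cancel2)
  have "coeff ?P (p + 1) = coeff (pcompose ?P ?T) (r * (p + 1))"
  \<comment> \<open>If the bound is attained, leading coefficients are compared, t^r being monic;
    otherwise both coefficients vanish.\<close>
  proof (cases "degree ?P = p + 1")
    case True
    have "0 < degree ?T" using \<open>r \<ge> 1\<close> by (simp only: degree_X_power)
    from lead_coeff_comp[OF this, of ?P]
    have "coeff (pcompose ?P ?T) ((p + 1) * r) = coeff ?P (p + 1)"
      unfolding deg True by (simp add: lead_coeff_power)
    then show ?thesis by (simp only: mult.commute)
  next
    case False
    then have "degree ?P < p + 1" using le by simp
    then have "degree ?P * r < (p + 1) * r" using \<open>r \<ge> 1\<close> by (intro mult_strict_right_mono) auto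
    then have "degree (pcompose ?P ?T) < r * (p + 1)" by (simp only: deg mult.commute)
    with \<open>degree ?P < p + 1\<close> show ?thesis by (simp only: coeff_eq_0)
  qed
  also have "\<dots> = lead_const p r b"
    by (simp only: pcompose_det_symbol_poly top(2) coeff_graded_symbol[OF \<open>p \<ge> 1\<close>]
        det_wrap_mat_top[OF \<open>r \<ge> 1\<close>])
  finally show "coeff ?P (p + 1) = lead_const p r b" .
qed

text \<open>z = 0 corresponds to t = 0, where only the diagonal \<open>k = 0\<close>
  survives.\<close>

lemma poly_det_symbol_poly_0:
  assumes "r \<ge> 1"
  shows "poly (Determinant.det (symbol_poly p r b x)) 0 = (-1) ^ (r - 1)"
proof -
  have "poly (Determinant.det (symbol_poly p r b x)) 0 = poly (Determinant.det (graded_symbol p r b x)) 0"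
    unfolding pcompose_det_symbol_poly[symmetric] using assms by (cases r) (simp_all add: poly_pcompose)
  also have "\<dots> = Determinant.det (map_mat (\<lambda>q. poly q 0) (graded_symbol p r b x))"
    using comm_ring_hom.hom_det[OF comm_ring_hom_poly] by metis
  also have "map_mat (\<lambda>q. poly q 0) (graded_symbol p r b x) = wrap_mat r (p + 1) (\<lambda>k j. if k = 0 then 1 else 0)"
    unfolding graded_symbol_def comm_ring_hom.hom_wrap_mat[OF comm_ring_hom_poly]
    by (rule wrap_mat_cong) (simp add: poly_monom symbol_coeff_def)
  finally show ?thesis by (simp only: det_wrap_mat_superdiagonal[OF assms])
qed

text \<open>The minor has size r - 1, so the graded one has degree at most (r - 1)(p + 1) < r(p + 1)
  in t. For the last row the extra factor \<open>[:0, 1:] ^ ((i + 1) mod r)\<close> is 1 and does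
  not spoil this bound.\<close>

lemma degree_minor_symbol_poly:
  assumes "j < r"
  shows "degree (Determinant.det (mat_delete (symbol_poly p r b x) (r - 1) j)) \<le> p" (is "degree ?M \<le> p")
proof (cases "?M = 0")
  case False
  let ?T = "[:0, 1 :: complex:] ^ r"
  have r: "r - 1 < r" "(r - 1 + 1) mod r = 0" using assms by auto
  have "degree (mat_delete (graded_symbol p r b x) (r - 1) j $$ (i', j')) \<le> p + 1"
    if "i' < r - 1" "j' < r - 1" for i' j'
    unfolding mat_delete_nth[OF graded_symbol_carrier r(1) assms that]
    by (intro degree_graded_symbol_nth insert_index_less r(1) assms that)
  from coeff_det_bounded(1)[OF mat_delete_carrier[OF graded_symbol_carrier] this]
  have "degree ([:0, 1:] ^ j * pcompose ?M ?T) \<le> (r - 1) * (p + 1)"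
    unfolding pcompose_minor_symbol_poly[OF r(1) assms] r(2) by simp
  moreover have "degree ([:0, 1:] ^ j * pcompose ?M ?T) = j + degree ?M * r"
  proof -
    have "degree ?T > 0" using assms by (simp only: degree_X_power)
    then have "pcompose ?M ?T \<noteq> 0" using False by (simp only: pcompose_eq_0_iff not_False_eq_True)
    then show ?thesis
      by (subst degree_mult_eq) (simp_all only: degree_pcompose degree_X_power, auto)
  qed
  moreover have "(p + 1) * (r - 1) < (p + 1) * r"
    using assms by (intro mult_strict_left_mono) auto
  then have "(r - 1) * (p + 1) < (p + 1) * r" by (simp only: mult.commute)
  ultimately have "degree ?M * r < (p + 1) * r" by linarith
  then have "degree ?M < p + 1" by (simp only: mult_less_cancel2)
  then show ?thesis by simp
qed simp

subsection \<open>Generating functions\<close>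

text \<open>Without the last row and column c the matrix is block lower triangular. The leading
  block gives Q at c; the other is triangular with the superdiagonal entries -1 of xI - H on its
  diagonal.\<close>

lemma hessenberg_minor:
  assumes super: "\<And>i. H i (i + 1) = 1" and zero: "\<And>i j. i + 1 < j \<Longrightarrow> H i j = 0" and "c \<le> n"
  shows "Determinant.det (mat_delete (x \<cdot>\<^sub>m 1\<^sub>m (Suc n) - truncation H (Suc n)) n c) = (-1) ^ (n - c) * Q H c x"
proof -
  define e where "e i j = (if i = j then x else 0) - H i j" for i j
  have e: "e i j = - 1" if "j = i + 1" for i j using that super by (simp add: e_def)
  have e0: "e i j = 0" if "i + 1 < j" for i j using that zero by (simp add: e_def)
  let ?A = "x \<cdot>\<^sub>m 1\<^sub>m c - truncation H c"
  \<comment> \<open>The \<open>+ 1\<close> arises because the columns after the deleted one move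
    left.\<close>
  define L where "L = Matrix.mat (n - c) (n - c) (\<lambda>(i, j). e (c + i) (c + j + 1))"
  define B where "B = Matrix.mat (n - c) c (\<lambda>(i, j). e (c + i) j)"
  have A: "?A \<in> carrier_mat c c" by (auto intro!: minus_carrier_mat simp: truncation_def)
  have L: "L \<in> carrier_mat (n - c) (n - c)" and B: "B \<in> carrier_mat (n - c) c" by (simp_all add: L_def B_def)
  have "mat_delete (x \<cdot>\<^sub>m 1\<^sub>m (Suc n) - truncation H (Suc n)) n c
      = four_block_mat ?A (0\<^sub>m c (n - c)) B L"
  proof (rule eq_matI)
    fix i j assume "i < dim_row (four_block_mat ?A (0\<^sub>m c (n - c)) B L)"
      "j < dim_col (four_block_mat ?A (0\<^sub>m c (n - c)) B L)"
    then have ij: "i < n" "j < n" using A L \<open>c \<le> n\<close> by (auto simp: truncation_def)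
    have "mat_delete (x \<cdot>\<^sub>m 1\<^sub>m (Suc n) - truncation H (Suc n)) n c $$ (i, j)
        = e i (if j < c then j else j + 1)"
      using ij by (simp add: mat_delete_def truncation_def e_def)
    also have "\<dots> = four_block_mat ?A (0\<^sub>m c (n - c)) B L $$ (i, j)"
      using ij A L B \<open>c \<le> n\<close> by (auto simp: truncation_def e_def[symmetric] L_def B_def e0)
        (simp_all add: e_def)
    finally show "mat_delete (x \<cdot>\<^sub>m 1\<^sub>m (Suc n) - truncation H (Suc n)) n c $$ (i, j)
        = four_block_mat ?A (0\<^sub>m c (n - c)) B L $$ (i, j)" .
  qed (use A L \<open>c \<le> n\<close> in \<open>auto simp: truncation_def\<close>)
  moreover have "Determinant.det L = (-1) ^ (n - c)"
  proof -
    have "Determinant.det L = prod_list (diag_mat L)"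
      by (rule det_lower_triangular[OF _ L]) (auto simp: L_def e0)
    also have "\<dots> = (\<Prod>i = 0..<n - c. - 1)"
      unfolding prod_list_diag_prod by (rule prod.cong) (auto simp: L_def e)
    finally show ?thesis by simp
  qed
  ultimately show ?thesis
    using det_four_block_mat_upper_right_zero[OF A refl B L] by (simp add: Q_def)
qed

lemma Q_0: "Q H 0 x = 1"
  unfolding Q_def by (rule det_dim_zero) (auto intro!: minus_carrier_mat simp: truncation_def)

text \<open>Laplace expansion along the last row: the cofactor sign cancels the sign of the
  Hessenberg minor.\<close>

lemma Q_Suc:
  assumes super: "\<And>i. H i (i + 1) = 1" and zero: "\<And>i j. i + 1 < j \<Longrightarrow> H i j = 0"
  shows "Q H (Suc n) x = x * Q H n x - (\<Sum>c\<le>n. H n c * Q H c x)"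
proof -
  let ?A = "x \<cdot>\<^sub>m 1\<^sub>m (Suc n) - truncation H (Suc n)"
  have "Q H (Suc n) x = (\<Sum>c<Suc n. ?A $$ (n, c) * cofactor ?A n c)"
    unfolding Q_def by (rule laplace_expansion_row) (auto intro!: minus_carrier_mat simp: truncation_def)
  also have "\<dots> = (\<Sum>c\<le>n. (if c = n then x * Q H c x else 0) - H n c * Q H c x)"
    unfolding lessThan_Suc_atMost
  proof (rule sum.cong[OF refl])
    fix c assume "c \<in> {..n}"
    then have "c \<le> n" by simp
    have "(-1 :: complex) ^ (n + c) * (-1) ^ (n - c) = 1"
      using \<open>c \<le> n\<close> by (simp flip: power_add)
    moreover have "Determinant.det (mat_delete ?A n c) = (-1) ^ (n - c) * Q H c x"
      by (rule hessenberg_minor) (simp_all only: super zero \<open>c \<le> n\<close>)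
    ultimately have "cofactor ?A n c = Q H c x"
      unfolding cofactor_def by (simp only: mult.assoc[symmetric] mult_1_left)
    moreover have "?A $$ (n, c) = (if c = n then x else 0) - H n c"
      using \<open>c \<le> n\<close> by (auto simp: truncation_def)
    ultimately show "?A $$ (n, c) * cofactor ?A n c = (if c = n then x * Q H c x else 0) - H n c * Q H c x"
      by (simp add: left_diff_distrib)
  qed
  also have "\<dots> = x * Q H n x - (\<Sum>c\<le>n. H n c * Q H c x)"
    by (simp add: sum_subtractf sum.delta)
  finally show ?thesis .
qed

text \<open>All terms are on one side: \<open>k = 0\<close> is the newest Q,
  \<open>(m - k) mod r\<close> is the column reduced by periodicity, and the condition
  \<open>k \<le> m\<close> makes Q zero at negative indices. The case \<open>m = 0\<close> records
  the initial value.\<close>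

lemma Q_hessenberg_recurrence:
  assumes per: "exactly_periodic p r b a" and "r \<ge> 1"
  shows "(\<Sum>k\<le>p + 1. if k \<le> m then symbol_coeff b x k ((m - k) mod r) * Q (hessenberg p a) (m - k) x else 0)
       = (if m = 0 then 1 else 0)"
proof (cases m)
  case 0
  have "(\<Sum>k\<le>p + 1. if k \<le> m then symbol_coeff b x k ((m - k) mod r) * Q (hessenberg p a) (m - k) x else 0)
      = (\<Sum>k\<le>p + 1. if k = 0 then 1 else 0)"
    using 0 by (intro sum.cong) (auto simp: symbol_coeff_def Q_0)
  then show ?thesis using 0 by (simp only: sum.delta finite_atMost) simp
next
  case (Suc n)
  let ?q = "\<lambda>m. Q (hessenberg p a) m x"
  have a: "a k j = b k (j mod r)" if "k \<le> p" for k j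
  proof -
    have "a k (r * (j div r) + j mod r) = b k (j mod r)"
      using per[unfolded exactly_periodic_def, rule_format, of "j mod r" k "j div r"] that \<open>r \<ge> 1\<close> by simp
    then show ?thesis by simp
  qed
  \<comment> \<open>The sum is indexed by the diagonal \<open>k\<close> in place of the column
    \<open>c\<close>.\<close>
  have "(\<Sum>c\<le>n. hessenberg p a n c * ?q c) = (\<Sum>k\<le>n. hessenberg p a n (n - k) * ?q (n - k))"
    by (rule sum.reindex_bij_witness[of _ "\<lambda>k. n - k" "\<lambda>k. n - k"]) auto
  also have "\<dots> = (\<Sum>k\<in>{..n} \<inter> {..p}. b k ((n - k) mod r) * ?q (n - k))"
    by (intro sum.mono_neutral_cong_right) (auto simp: hessenberg_def a)
  also have "\<dots> = (\<Sum>k\<le>p. if k \<le> n then b k ((n - k) mod r) * ?q (n - k) else 0)"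
    by (intro sum.mono_neutral_cong_left) auto
  finally have "?q m = x * ?q n - (\<Sum>k\<le>p. if k \<le> n then b k ((n - k) mod r) * ?q (n - k) else 0)"
    unfolding Suc by (subst Q_Suc) (auto simp: hessenberg_def)
  \<comment> \<open>Written as a summand at index 0, this term merges into
    \<open>symbol_coeff\<close> at index 1 after the shift.\<close>
  moreover have "x * ?q n = (\<Sum>k\<le>p. if k = 0 then x * ?q n else 0)" by (simp only: sum.delta finite_atMost) simp
  ultimately have "?q m = - (\<Sum>k\<le>p. (if k \<le> n then b k ((n - k) mod r) * ?q (n - k) else 0) - (if k = 0 then x * ?q n else 0))"
    by (simp only: sum_subtractf) simp
  also have "(\<Sum>k\<le>p. (if k \<le> n then b k ((n - k) mod r) * ?q (n - k) else 0) - (if k = 0 then x * ?q n else 0))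
      = (\<Sum>k\<le>p. if Suc k \<le> m then symbol_coeff b x (Suc k) ((m - Suc k) mod r) * ?q (m - Suc k) else 0)"
    unfolding Suc by (intro sum.cong) (auto simp: symbol_coeff_def left_diff_distrib)
  finally show ?thesis
    unfolding Suc_eq_plus1[symmetric] sum.atMost_Suc_shift
    using Suc by (simp add: symbol_coeff_def)
qed

text \<open>Cramer's rule through the adjugate avoids dividing by the determinant, so it applies
  over formal power series.\<close>

lemma cramer_adjugate:
  fixes A :: "'a::comm_ring_1 mat"
  assumes A: "A \<in> carrier_mat n n" and l: "l < n"
    and eq: "\<And>i. i < n \<Longrightarrow> (\<Sum>j<n. A $$ (i, j) * v j) = e i"
  shows "Determinant.det A * v l = (\<Sum>i<n. cofactor A i l * e i)"
proof -
  have adj: "(\<Sum>i<n. cofactor A i l * A $$ (i, j)) = (if l = j then Determinant.det A else 0)" if "j < n" for j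
  proof -
    have "(adj_mat A * A) $$ (l, j) = (\<Sum>i<n. cofactor A i l * A $$ (i, j))"
      using A l that by (simp add: scalar_prod_def adj_mat_def lessThan_atLeast0)
    moreover have "(adj_mat A * A) $$ (l, j) = (if l = j then Determinant.det A else 0)"
      unfolding adj_mat(3)[OF A] using l that by simp
    ultimately show ?thesis by metis
  qed
  have "(\<Sum>i<n. cofactor A i l * e i) = (\<Sum>i<n. \<Sum>j<n. cofactor A i l * A $$ (i, j) * v j)"
    by (intro sum.cong) (auto simp: eq[symmetric] sum_distrib_left mult.assoc)
  also have "\<dots> = (\<Sum>j<n. (\<Sum>i<n. cofactor A i l * A $$ (i, j)) * v j)"
    by (subst sum.swap) (simp add: sum_distrib_right)
  also have "\<dots> = (\<Sum>j<n. if l = j then Determinant.det A * v j else 0)"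
    by (intro sum.cong) (auto simp: adj)
  finally show ?thesis using l by (simp add: sum.delta)
qed

section \<open>The linear system for the generating functions\<close>

lemma comm_ring_hom_fps_of_poly: "comm_ring_hom (fps_of_poly :: 'a::comm_ring_1 poly \<Rightarrow> 'a fps)"
  by unfold_locales (auto simp: fps_of_poly_add fps_of_poly_mult)

lemma fps_of_poly_symbol_poly:
  "map_mat fps_of_poly (symbol_poly p r b x) =
    wrap_mat r (p + 1) (\<lambda>k j. fps_const (symbol_coeff b x k j) * fps_X ^ ((j + k) div r))"
proof -
  have "symbol_coeff (\<lambda>k j. fps_const (b k j)) (fps_const x) k j = fps_const (symbol_coeff b x k j)" for k j
    by (simp add: symbol_coeff_def)
  then show ?thesis
    unfolding symbol_poly_def comm_ring_hom.hom_cleared_symbol[OF comm_ring_hom_fps_of_poly]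
    by (simp add: cleared_symbol_def fps_of_poly_const)
qed

text \<open>For fixed k, at most one column j contributes to the coefficient of z^n in the row with
  residue s, and the Q met there has index rn + s - k. The condition on the quotient says that this
  index is not negative.\<close>

lemma residue_reindex:
  fixes r n j k s :: nat
  assumes "j < r" "s < r"
  shows "(j + k) mod r = s \<and> (j + k) div r \<le> n \<longleftrightarrow> k \<le> r * n + s \<and> j = (r * n + s - k) mod r" (is "?L \<longleftrightarrow> ?R")
    and "(j + k) mod r = s \<Longrightarrow> (j + k) div r \<le> n \<Longrightarrow> r * (n - (j + k) div r) + j = r * n + s - k"
proof -
  show eq: "r * (n - (j + k) div r) + j = r * n + s - k" if "(j + k) mod r = s" "(j + k) div r \<le> n"
  proof -
    have "j + k = r * ((j + k) div r) + s" using that(1) by (metis mult_div_mod_eq)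
    moreover have "r * n = r * (n - (j + k) div r) + r * ((j + k) div r)"
      using that(2) by (simp flip: distrib_left)
    ultimately show ?thesis by linarith
  qed
  show "?L \<longleftrightarrow> ?R"
  proof
    assume L: ?L
    have "j + k = r * ((j + k) div r) + s" using L by (metis mult_div_mod_eq)
    moreover have "r * ((j + k) div r) \<le> r * n" using L by simp
    ultimately have "k \<le> r * n + s" by linarith
    moreover have "(r * n + s - k) mod r = j" using eq L assms by (metis mod_less mod_mult_self4)
    ultimately show ?R by simp
  next
    assume R: ?R
    define t where "t = (r * n + s - k) div r"
    have t: "r * n + s - k = r * t + j" using R unfolding t_def by (metis mult_div_mod_eq)
    have "r * t < r * (n + 1)" using t R assms by (simp add: distrib_left)
    then have "t < n + 1" by (simp only: mult_less_cancel1)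
    then have "t \<le> n" by simp
    then have "r * n = r * (n - t) + r * t" by (simp flip: distrib_left)
    with t R have jk: "j + k = s + r * (n - t)" by linarith
    show ?L unfolding jk using assms by simp
  qed
qed

lemma if_reindex:
  assumes "P \<and> P' \<longleftrightarrow> K \<and> j = J" "P \<Longrightarrow> P' \<Longrightarrow> m = m'"
  shows "(if P \<and> P' then c j * q m else 0) = (if j = J then (if K then c J * q m' else 0) else (0 :: 'a::mult_zero))"
  using assms by auto

text \<open>Row i at z^n is the recurrence for Q at m = rn + (i + 1) mod r. This m is zero only for
  n = 0 in the last row, whence the last unit vector.\<close>

lemma fps_symbol_mult_Q:
  assumes per: "exactly_periodic p r b a" and "r \<ge> 1" and i: "i < r"
  shows "(\<Sum>j<r. map_mat fps_of_poly (symbol_poly p r b x) $$ (i, j) *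
            Abs_fps (\<lambda>n. Q (hessenberg p a) (r * n + j) x)) = (if i = r - 1 then 1 else 0)"
proof (rule fps_ext)
  fix n
  let ?q = "\<lambda>m. Q (hessenberg p a) m x" and ?c = "symbol_coeff b x" and ?s = "(i + 1) mod r"
  let ?G = "\<lambda>j. Abs_fps (\<lambda>n. ?q (r * n + j))"
  have s: "?s < r" using i by simp
  have "(\<Sum>j<r. map_mat fps_of_poly (symbol_poly p r b x) $$ (i, j) * ?G j) $ n
      = (\<Sum>j<r. \<Sum>k\<le>p + 1. if (j + k) mod r = ?s \<and> (j + k) div r \<le> n
            then ?c k j * ?q (r * (n - (j + k) div r) + j) else 0)"
    unfolding fps_sum_nth
  proof (rule sum.cong[OF refl])
    fix j assume "j \<in> {..<r}"
    then have j: "j < r" by simp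
    have term_nth: "((if (j + k) mod r = ?s then fps_const (?c k j) * fps_X ^ ((j + k) div r) else 0) * ?G j) $ n
        = (if (j + k) mod r = ?s \<and> (j + k) div r \<le> n
            then ?c k j * ?q (r * (n - (j + k) div r) + j) else 0)" for k
      by (cases "(j + k) mod r = ?s"; cases "(j + k) div r \<le> n")
        (simp_all only: mult.assoc fps_mult_left_const_nth fps_X_power_mult_nth fps_nth_Abs_fps
          if_True if_False mult_zero_left fps_zero_nth simp_thms not_less[symmetric] mult_zero_right)
    show "(map_mat fps_of_poly (symbol_poly p r b x) $$ (i, j) * ?G j) $ n
      = (\<Sum>k\<le>p + 1. if (j + k) mod r = ?s \<and> (j + k) div r \<le> n
            then ?c k j * ?q (r * (n - (j + k) div r) + j) else 0)"
      unfolding fps_of_poly_symbol_poly wrap_mat_nth[OF i j] sum_distrib_right fps_sum_nth term_nth ..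
  qed
  also have "\<dots> = (\<Sum>k\<le>p + 1. \<Sum>j<r. if (j + k) mod r = ?s \<and> (j + k) div r \<le> n
            then ?c k j * ?q (r * (n - (j + k) div r) + j) else 0)"
    by (rule sum.swap)
  also have "\<dots> = (\<Sum>k\<le>p + 1. if k \<le> r * n + ?s
      then ?c k ((r * n + ?s - k) mod r) * ?q (r * n + ?s - k) else 0)"
  proof (rule sum.cong[OF refl])
    fix k
    have "(if (j + k) mod r = ?s \<and> (j + k) div r \<le> n then ?c k j * ?q (r * (n - (j + k) div r) + j) else 0)
        = (if j = (r * n + ?s - k) mod r then
            (if k \<le> r * n + ?s then ?c k ((r * n + ?s - k) mod r) * ?q (r * n + ?s - k) else 0) else 0)"
      if "j \<in> {..<r}" for j
    proof -
      have "j < r" using that by simp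
      from residue_reindex[OF this s, of k n] show ?thesis by (rule if_reindex)
    qed
    then have "(\<Sum>j<r. if (j + k) mod r = ?s \<and> (j + k) div r \<le> n
            then ?c k j * ?q (r * (n - (j + k) div r) + j) else 0)
        = (\<Sum>j<r. if j = (r * n + ?s - k) mod r then
            (if k \<le> r * n + ?s then ?c k ((r * n + ?s - k) mod r) * ?q (r * n + ?s - k) else 0) else 0)"
      by (rule sum.cong[OF refl])
    also have "\<dots> = (if k \<le> r * n + ?s then ?c k ((r * n + ?s - k) mod r) * ?q (r * n + ?s - k) else 0)"
      using \<open>r \<ge> 1\<close> by (subst sum.delta) auto
    finally show "(\<Sum>j<r. if (j + k) mod r = ?s \<and> (j + k) div r \<le> n
            then ?c k j * ?q (r * (n - (j + k) div r) + j) else 0)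
        = (if k \<le> r * n + ?s then ?c k ((r * n + ?s - k) mod r) * ?q (r * n + ?s - k) else 0)" .
  qed
  also have "\<dots> = (if r * n + ?s = 0 then 1 else 0)"
    by (rule Q_hessenberg_recurrence[OF per \<open>r \<ge> 1\<close>])
  also have "\<dots> = (if i = r - 1 then 1 else 0 :: complex fps) $ n"
  proof -
    have "?s = 0 \<longleftrightarrow> i = r - 1" using i by (cases "i = r - 1") auto
    then show ?thesis using \<open>r \<ge> 1\<close> by simp
  qed
  finally show "(\<Sum>j<r. map_mat fps_of_poly (symbol_poly p r b x) $$ (i, j) * ?G j) $ n
      = (if i = r - 1 then 1 else 0 :: complex fps) $ n" .
qed

lemma det_symbol_mult_Q_fps:
  assumes per: "exactly_periodic p r b a" and "r \<ge> 1" and j: "j < r"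
  shows "fps_of_poly (Determinant.det (symbol_poly p r b x)) * Abs_fps (\<lambda>n. Q (hessenberg p a) (r * n + j) x)
    = fps_of_poly (Polynomial.smult ((-1) ^ (r - 1 + j)) (Determinant.det (mat_delete (symbol_poly p r b x) (r - 1) j)))"
proof -
  let ?A = "map_mat fps_of_poly (symbol_poly p r b x)"
  have A: "?A \<in> carrier_mat r r" by simp
  have r: "r - 1 < r" using \<open>r \<ge> 1\<close> by simp
  have "Determinant.det ?A * Abs_fps (\<lambda>n. Q (hessenberg p a) (r * n + j) x)
      = (\<Sum>i<r. cofactor ?A i j * (if i = r - 1 then 1 else 0))"
    by (rule cramer_adjugate[OF A j fps_symbol_mult_Q[OF per \<open>r \<ge> 1\<close>]])
  also have "\<dots> = (\<Sum>i<r. if i = r - 1 then cofactor ?A i j else 0)"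
    by (intro sum.cong) auto
  also have "\<dots> = cofactor ?A (r - 1) j" using r by (simp add: sum.delta)
  also have "\<dots> = (-1) ^ (r - 1 + j) * fps_of_poly (Determinant.det (mat_delete (symbol_poly p r b x) (r - 1) j))"
    unfolding cofactor_def comm_ring_hom.hom_minor[OF comm_ring_hom_fps_of_poly symbol_poly_carrier r j] ..
  also have "(-1) ^ (r - 1 + j) = fps_const ((-1 :: complex) ^ (r - 1 + j))"
    by (simp flip: fps_const_power fps_const_neg)
  finally show ?thesis
    unfolding comm_ring_hom.hom_det[OF comm_ring_hom_fps_of_poly] fps_of_poly_smult .
qed

subsection \<open>Partial fractions\<close>

lemma degree_prod_linear:
  fixes w :: "'b \<Rightarrow> 'a::idom"
  shows "degree (\<Prod>i\<in>A. [:- w i, 1:]) = card A"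
  by (subst degree_prod_eq_sum_degree) auto

lemma poly_prod_linear: "poly (\<Prod>i\<in>A. [:- w i, 1:]) (z::'a::comm_ring_1) = (\<Prod>i\<in>A. z - w i)"
  by (simp add: poly_prod)

text \<open>Subtracting this multiple of the product cancels the coefficient at
  \<open>card A\<close>; a nonzero remainder would have more roots than its degree allows.\<close>

lemma poly_eq_prod_roots:
  fixes P :: "'a::idom poly"
  assumes deg: "degree P \<le> card A" and A: "finite A" "inj_on w A" and root: "\<And>i. i \<in> A \<Longrightarrow> poly P (w i) = 0"
  shows "P = Polynomial.smult (coeff P (card A)) (\<Prod>i\<in>A. [:- w i, 1:])"
proof -
  let ?R = "\<Prod>i\<in>A. [:- w i, 1:]"
  let ?D = "P - Polynomial.smult (coeff P (card A)) ?R"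
  have dR: "degree ?R = card A" by (rule degree_prod_linear)
  have lR: "coeff ?R (card A) = 1" unfolding dR[symmetric] by (simp add: lead_coeff_prod)
  have "?D = 0"
  proof (rule ccontr)
    assume D: "?D \<noteq> 0"
    have "degree ?D \<le> card A"
      using deg dR by (intro degree_diff_le order.trans[OF degree_smult_le]) auto
    moreover have "coeff ?D (card A) = 0" using lR by simp
    ultimately have "degree ?D < card A"
      using D by (metis leading_coeff_0_iff le_neq_implies_less)
    moreover have "w ` A \<subseteq> {z. poly ?D z = 0}"
      using root A by (auto simp: poly_prod_linear)
    then have "card (w ` A) \<le> degree ?D"
      using card_mono[OF poly_roots_finite[OF D]] card_poly_roots_bound[OF D] by (meson order.trans)
    ultimately show False by (simp add: card_image A)
  qed
  then show ?thesis by simp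
qed

lemma lagrange_interpolation:
  fixes M :: "'a::field poly"
  assumes deg: "degree M < card A" and A: "finite A" "inj_on w A"
  shows "M = (\<Sum>k\<in>A. Polynomial.smult (poly M (w k) / (\<Prod>i\<in>A - {k}. w k - w i)) (\<Prod>i\<in>A - {k}. [:- w i, 1:]))"
    (is "M = ?L")
proof (rule poly_eqI_degree[of "w ` A"])
  fix z assume "z \<in> w ` A"
  then obtain l where l: "l \<in> A" "z = w l" by auto
  have "poly ?L z = (\<Sum>k\<in>A. if k = l then poly M (w l) else 0)"
    unfolding poly_sum
  proof (rule sum.cong[OF refl])
    fix k assume k: "k \<in> A"
    show "poly (Polynomial.smult (poly M (w k) / (\<Prod>i\<in>A - {k}. w k - w i)) (\<Prod>i\<in>A - {k}. [:- w i, 1:])) z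
        = (if k = l then poly M (w l) else 0)"
    proof (cases "k = l")
      case True
      have "(\<Prod>i\<in>A - {l}. w l - w i) \<noteq> 0" using A l by (auto simp: inj_on_def)
      then show ?thesis using True l by (simp add: poly_prod_linear)
    next
      case False
      then have "(\<Prod>i\<in>A - {k}. z - w i) = 0" using A l by auto
      then show ?thesis using False by (simp add: poly_prod_linear)
    qed
  qed
  then show "poly M z = poly ?L z" using l A by (simp add: sum.delta)
next
  have "degree ?L \<le> card A - 1"
    using A by (intro degree_sum_le order.trans[OF degree_smult_le]) (auto simp: degree_prod_linear)
  then show "degree ?L < card (w ` A)" using deg A by (simp add: card_image)
  show "degree M < card (w ` A)" using deg A by (simp add: card_image)
qed

text \<open>The series is the geometric expansion of 1/(w - z) at the origin.\<close>

lemma fps_linear_mult_geometric: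
  fixes w :: "'a::field"
  assumes "w \<noteq> 0"
  shows "fps_of_poly [:- w, 1:] * Abs_fps (\<lambda>n. w powi (- int n - 1)) = - 1"
proof (rule fps_ext)
  fix n
  have "fps_of_poly [:- w, 1:] = fps_X - fps_const w"
    by (simp add: fps_of_poly_pCons flip: fps_const_neg)
  then have "fps_nth (fps_of_poly [:- w, 1:] * Abs_fps (\<lambda>n. w powi (- int n - 1))) n
      = (if n = 0 then 0 else w powi (- int (n - 1) - 1)) - w * w powi (- int n - 1)"
    by (simp only: left_diff_distrib fps_sub_nth fps_X_mult_nth fps_mult_left_const_nth fps_nth_Abs_fps)
  also have "w * w powi (- int n - 1) = w powi (- int n)"
    using assms by (simp add: power_int_diff)
  also have "(if n = 0 then 0 else w powi (- int (n - 1) - 1)) = (if n = 0 then 0 else w powi (- int n))"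
  proof (cases "n = 0")
    case False
    then have "- int (n - 1) - 1 = - int n" by simp
    then show ?thesis by (simp only:)
  qed simp
  finally show "fps_nth (fps_of_poly [:- w, 1:] * Abs_fps (\<lambda>n. w powi (- int n - 1))) n = fps_nth (- 1) n"
    by (cases n) simp_all
qed

lemma fps_quotient_partial_fractions:
  fixes P M :: "'a::field poly"
  assumes degP: "degree P \<le> p + 1" and L: "coeff P (p + 1) \<noteq> 0" and degM: "degree M \<le> p"
    and w: "inj_on w {..p}" "\<And>k. k \<le> p \<Longrightarrow> w k \<noteq> 0" "\<And>k. k \<le> p \<Longrightarrow> poly P (w k) = 0"
    and eq: "fps_of_poly P * F = fps_of_poly M"
  shows "fps_nth F n = - (1 / coeff P (p + 1)) *
    (\<Sum>k\<le>p. poly M (w k) / (\<Prod>i\<in>{..p} - {k}. w k - w i) * w k powi (- int n - 1))"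
proof -
  define L where "L = coeff P (p + 1)"
  define m where "m k = poly M (w k) / (\<Prod>i\<in>{..p} - {k}. w k - w i)" for k
  define g where "g k = Abs_fps (\<lambda>n. w k powi (- int n - 1))" for k
  define R where "R k = (\<Prod>i\<in>{..p} - {k}. [:- w i, 1:])" for k
  \<comment> \<open>The candidate for the quotient: the partial fractions of M/P, expanded at
    0.\<close>
  define F' where "F' = (\<Sum>k\<le>p. fps_const (- (1 / L) * m k) * g k)"
  have "L \<noteq> 0" using L by (simp add: L_def)
  have P: "P = Polynomial.smult L (\<Prod>i\<in>{..p}. [:- w i, 1:])"
    using poly_eq_prod_roots[of P "{..p}" w] degP w by (simp add: L_def)
  have "fps_of_poly P * (fps_const (- (1 / L) * m k) * g k) = fps_of_poly (Polynomial.smult (m k) (R k))"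
    if "k \<le> p" for k
  proof -
    have "(\<Prod>i\<in>{..p}. [:- w i, 1:]) = [:- w k, 1:] * R k"
      unfolding R_def using that by (intro prod.remove) auto
    then have "fps_of_poly P = fps_const L * (fps_of_poly [:- w k, 1:] * fps_of_poly (R k))"
      by (simp only: P fps_of_poly_smult fps_of_poly_mult)
    then have "fps_of_poly P * (fps_const (- (1 / L) * m k) * g k)
        = (fps_const L * fps_const (- (1 / L) * m k)) * ((fps_of_poly [:- w k, 1:] * g k) * fps_of_poly (R k))"
      by (simp only: mult_ac)
    also have "fps_of_poly [:- w k, 1:] * g k = - 1"
      unfolding g_def by (rule fps_linear_mult_geometric[OF w(2)[OF that]])
    also have "fps_const L * fps_const (- (1 / L) * m k) = fps_const (- m k)"
      using \<open>L \<noteq> 0\<close> by simp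
    finally show ?thesis by (simp add: fps_of_poly_smult flip: fps_const_neg)
  qed
  then have "fps_of_poly P * F' = fps_of_poly (\<Sum>k\<le>p. Polynomial.smult (m k) (R k))"
    unfolding F'_def sum_distrib_left fps_of_poly_sum by (intro sum.cong) auto
  \<comment> \<open>Interpolation at the p + 1 roots recovers \<open>M\<close>, whose degree is at
    most p.\<close>
  also have "(\<Sum>k\<le>p. Polynomial.smult (m k) (R k)) = M"
    unfolding m_def R_def using lagrange_interpolation[of M "{..p}" w] degM w(1) by simp
  also have "fps_of_poly M = fps_of_poly P * F" by (simp only: eq)
  finally have "fps_of_poly P * F' = fps_of_poly P * F" .
  \<comment> \<open>Power series over a field form an integral domain, so \<open>P\<close> can be
    cancelled.\<close>
  moreover have "fps_of_poly P \<noteq> 0" using L by auto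
  ultimately have "F = F'" by simp
  then show ?thesis
    by (simp add: F'_def g_def m_def L_def fps_sum_nth sum_distrib_left mult.assoc sum_negf)
qed

lemma Q_eq_sum_roots:
  assumes "p \<ge> 1" "r \<ge> 1" and per: "exactly_periodic p r b a" and nz: "\<forall>k<r. b p k \<noteq> 0"
    and w: "inj_on w {..p}" "\<And>k. k \<le> p \<Longrightarrow> w k \<noteq> 0" "\<And>k. k \<le> p \<Longrightarrow> symbol_det p r b (w k) x = 0"
    and j: "j < r"
  shows "Q (hessenberg p a) (r * n + j) x =
    (-1) ^ (r + j) / lead_const p r b *
      (\<Sum>k\<le>p. symbol_minor p r b (r - 1) j (w k) x / (\<Prod>i\<in>{..p} - {k}. w k - w i) * w k powi (- int n - 1))"
proof -
  let ?P = "Determinant.det (symbol_poly p r b x)"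
  let ?M = "Determinant.det (mat_delete (symbol_poly p r b x) (r - 1) j)"
  let ?s = "(-1 :: complex) ^ (r - 1 + j)"
  have r: "r - 1 < r" using j by simp
  have L: "lead_const p r b \<noteq> 0" using nz by (simp add: lead_const_def)
  note top = det_symbol_poly_top[OF \<open>p \<ge> 1\<close> \<open>r \<ge> 1\<close>, of b x]
  have "fps_nth (Abs_fps (\<lambda>n. Q (hessenberg p a) (r * n + j) x)) n
      = - (1 / coeff ?P (p + 1)) * (\<Sum>k\<le>p. poly (Polynomial.smult ?s ?M) (w k)
          / (\<Prod>i\<in>{..p} - {k}. w k - w i) * w k powi (- int n - 1))"
  proof (rule fps_quotient_partial_fractions)
    show "degree ?P \<le> p + 1" by (rule top(1))
    show "inj_on w {..p}" by (rule w(1))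
    show "w k \<noteq> 0" if "k \<le> p" for k using that by (rule w(2))
    show "fps_of_poly ?P * Abs_fps (\<lambda>n. Q (hessenberg p a) (r * n + j) x)
        = fps_of_poly (Polynomial.smult ?s ?M)" by (rule det_symbol_mult_Q_fps[OF per \<open>r \<ge> 1\<close> j])
    show "coeff ?P (p + 1) \<noteq> 0" unfolding top(2) by (rule L)
    show "degree (Polynomial.smult ?s ?M) \<le> p"
      using degree_minor_symbol_poly[OF j, of p b x] by simp
    show "poly ?P (w k) = 0" if "k \<le> p" for k
      unfolding poly_det_symbol_poly det_cleared_symbol[OF \<open>r \<ge> 1\<close> w(2)[OF that]] using w(3)[OF that] by simp
  qed
  also have "\<dots> = - (1 / lead_const p r b) * (\<Sum>k\<le>p. ?s * (symbol_minor p r b (r - 1) j (w k) x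
          / (\<Prod>i\<in>{..p} - {k}. w k - w i) * w k powi (- int n - 1)))"
    unfolding top(2)
  proof (rule arg_cong[where f = "(*) (- (1 / lead_const p r b))", OF sum.cong[OF refl]])
    fix k assume "k \<in> {..p}"
    \<comment> \<open>Here the last row is deleted, so no factor z remains.\<close>
    then have "poly ?M (w k) = symbol_minor p r b (r - 1) j (w k) x"
      unfolding poly_minor_symbol_poly[OF r j]
      using minor_cleared_symbol[OF \<open>r \<ge> 1\<close> w(2) r j, of k p b x] by simp
    then show "poly (Polynomial.smult ?s ?M) (w k) / (\<Prod>i\<in>{..p} - {k}. w k - w i) * w k powi (- int n - 1)
      = ?s * (symbol_minor p r b (r - 1) j (w k) x / (\<Prod>i\<in>{..p} - {k}. w k - w i) * w k powi (- int n - 1))"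
      by simp
  qed
  also have "- (1 / lead_const p r b) * (\<Sum>k\<le>p. ?s * f k) = (- ?s) / lead_const p r b * (\<Sum>k\<le>p. f k)" for f
    by (simp add: sum_distrib_left[symmetric])
  \<comment> \<open>The minus sign of 1/(z - w) = -1/(w - z) changes the exponent r - 1 + j to r +
    j.\<close>
  also have "- ?s = (-1) ^ (r + j)" using \<open>r \<ge> 1\<close> by (cases r) simp_all
  finally show ?thesis by simp
qed

subsection \<open>Finiteness of the zeros of the minors\<close>

text \<open>For the permutation matrix P with ones at \<open>(i, (i + 1) mod r)\<close>, this is the
  exponent below r of the power of P with a one at \<open>(i, j)\<close>.\<close>

definition cyclic_dist :: "nat \<Rightarrow> nat \<Rightarrow> nat \<Rightarrow> nat" where
  "cyclic_dist r i j = (if i \<le> j then j - i else j + r - i)"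

lemma cyclic_dist_Suc_mod:
  assumes "i < r" "j < r"
  shows "cyclic_dist r ((i + 1) mod r) j = (if i = j then r - 1 else cyclic_dist r i j - 1)"
    and "cyclic_dist r i j < r" and "i \<noteq> j \<Longrightarrow> cyclic_dist r i j \<ge> 1"
  using assms by (cases "i = r - 1"; auto simp: cyclic_dist_def)+

text \<open>Up to a common factor the cofactors are the entries of the inverse, and these are
  proportional to powers of 2. The value 2 serves because 2^r differs from 1.\<close>

lemma minor_shifted_permutation_nonzero:
  assumes "m \<ge> 1" and ij: "i < r" "j < r"
  shows "Determinant.det (mat_delete
      (wrap_mat r m (\<lambda>k j. if k = 0 then 1 else if k = 1 then - 2 else 0 :: complex)) i j) \<noteq> 0"
proof -
  define A where "A = wrap_mat r m (\<lambda>k j. if k = 0 then 1 else if k = 1 then - 2 else 0 :: complex)"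
  \<comment> \<open>With \<open>P\<close> the cyclic permutation matrix, \<open>A = P - 2\<close>, \<open>B = \<Sum>m<r. 2\<^sup>r\<^sup>-\<^sup>1\<^sup>-\<^sup>m P\<^sup>m\<close> and \<open>A B = 1 - 2\<^sup>r\<close>.\<close>
  define B where "B = Matrix.mat r r (\<lambda>(i, j). 2 ^ (r - 1 - cyclic_dist r i j) :: complex)"
  define d where "d = 1 - (2 :: complex) ^ r"
  have "(2 :: complex) ^ r \<noteq> 1"
  proof
    assume "(2 :: complex) ^ r = 1"
    then have "of_nat (2 ^ r) = (1 :: complex)" by simp
    then show False using ij by (simp only: of_nat_eq_1_iff) simp
  qed
  then have d: "d \<noteq> 0" by (simp add: d_def)
  have A: "A \<in> carrier_mat r r" and B: "B \<in> carrier_mat r r" by (simp_all add: A_def B_def)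
  have A_nth: "A $$ (i, l) = (if l = (i + 1) mod r then 1 else 0) + (if l = i then - 2 else 0)"
    if "i < r" "l < r" for i l
  proof -
    have "A $$ (i, l) = (\<Sum>k\<le>m. (if k = 0 then (if l = (i + 1) mod r then 1 else 0) else 0)
        + (if k = 1 then (if l = i then - 2 else 0) else 0))"
      unfolding A_def wrap_mat_nth[OF that]
    proof (rule sum.cong[OF refl])
      fix k
      have "(l + 1) mod r = (i + 1) mod r \<longleftrightarrow> l = i"
        using Suc_mod_eq_iff[OF that(1), of l] that(2) by (simp only: mod_less)
      then show "(if (l + k) mod r = (i + 1) mod r then if k = 0 then 1 else if k = 1 then - 2 else 0 else 0 :: complex)
        = (if k = 0 then (if l = (i + 1) mod r then 1 else 0) else 0) + (if k = 1 then (if l = i then - 2 else 0) else 0)"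
        using that(2) by (cases "k = 0"; cases "k = 1")
          (simp_all only: mod_less add_0_right zero_neq_one if_True if_False simp_thms add_0_left if_cancel)
    qed
    then show ?thesis using \<open>m \<ge> 1\<close> by (simp only: sum.distrib sum.delta finite_atMost atMost_iff) simp
  qed
  have "A * B = d \<cdot>\<^sub>m 1\<^sub>m r"
  proof (rule eq_matI)
    fix i j assume "i < dim_row (d \<cdot>\<^sub>m 1\<^sub>m r)" "j < dim_col (d \<cdot>\<^sub>m 1\<^sub>m r)"
    then have ij: "i < r" "j < r" by simp_all
    have "(A * B) $$ (i, j) = (\<Sum>l<r. A $$ (i, l) * B $$ (l, j))"
      using A B ij by (simp add: scalar_prod_def lessThan_atLeast0)
    also have "\<dots> = (\<Sum>l<r. (if l = (i + 1) mod r then B $$ (l, j) else 0) + (if l = i then - 2 * B $$ (l, j) else 0))"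
      using ij by (intro sum.cong refl) (simp add: A_nth distrib_right)
    also have "\<dots> = B $$ ((i + 1) mod r, j) - 2 * B $$ (i, j)"
      using ij by (simp only: sum.distrib sum.delta finite_lessThan lessThan_iff) simp
    also have "\<dots> = 2 ^ (r - 1 - cyclic_dist r ((i + 1) mod r) j) - 2 * 2 ^ (r - 1 - cyclic_dist r i j)"
      using ij by (simp add: B_def)
    \<comment> \<open>Off the diagonal a step shortens the distance by one and the two powers
      cancel; on it the step wraps to distance r - 1 and leaves 1 - 2^r.\<close>
    also have "\<dots> = (if i = j then d else 0)"
    proof (cases "i = j")
      case True
      have "2 * 2 ^ (r - 1) = (2 :: complex) ^ r" using ij by (cases r) simp_all
      moreover have "cyclic_dist r i j = 0" using True by (simp add: cyclic_dist_def)
      ultimately show ?thesis unfolding cyclic_dist_Suc_mod(1)[OF ij] using True by (simp add: d_def)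
    next
      case False
      note cd = cyclic_dist_Suc_mod[OF ij]
      have "r - 1 - (cyclic_dist r i j - 1) = Suc (r - 1 - cyclic_dist r i j)"
        using cd(2) cd(3)[OF False] by linarith
      then have "(2 :: complex) ^ (r - 1 - (cyclic_dist r i j - 1)) = 2 * 2 ^ (r - 1 - cyclic_dist r i j)"
        by (simp only: power_Suc)
      then show ?thesis unfolding cd(1) if_not_P[OF False] by (simp only: diff_self)
    qed
    also have "\<dots> = (d \<cdot>\<^sub>m 1\<^sub>m r) $$ (i, j)" using ij by simp
    finally show "(A * B) $$ (i, j) = (d \<cdot>\<^sub>m 1\<^sub>m r) $$ (i, j)" .
  qed (use A B in auto)
  note AB = this
  have "Determinant.det A * Determinant.det B = d ^ r"
    using Determinant.det_mult[OF A B] by (simp add: AB)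
  then have detA: "Determinant.det A \<noteq> 0" using d by auto
  have adj: "adj_mat A \<in> carrier_mat r r" using adj_mat(1)[OF A] .
  \<comment> \<open>Multiplying \<open>A * B\<close> by the adjugate from the left makes the
    cofactors multiples of the entries of \<open>B\<close>.\<close>
  have "d \<cdot>\<^sub>m adj_mat A = adj_mat A * (A * B)"
    unfolding AB using adj by (simp add: mult_smult_distrib[OF adj one_carrier_mat])
  also have "\<dots> = (adj_mat A * A) * B" using assoc_mult_mat[OF adj A B] by (rule sym)
  also have "\<dots> = Determinant.det A \<cdot>\<^sub>m B"
    unfolding adj_mat(3)[OF A] using B by (simp add: mult_smult_assoc_mat[OF one_carrier_mat B])
  finally have eq: "d \<cdot>\<^sub>m adj_mat A = Determinant.det A \<cdot>\<^sub>m B" .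
  have "d * cofactor A i j = (d \<cdot>\<^sub>m adj_mat A) $$ (j, i)"
    using A ij by (simp add: adj_mat_def)
  also have "\<dots> = Determinant.det A * 2 ^ (r - 1 - cyclic_dist r j i)"
    unfolding eq using B ij by (simp add: B_def)
  finally have "cofactor A i j \<noteq> 0" using detA by auto
  then show ?thesis unfolding A_def cofactor_def by simp
qed

lemma poly_zero_off_zero:
  fixes q :: "'a::{idom,ring_char_0} poly"
  assumes "\<And>t. t \<noteq> 0 \<Longrightarrow> poly q t = 0"
  shows "q = 0"
proof (rule ccontr)
  assume "q \<noteq> 0"
  then have "finite (insert 0 {t. poly q t = 0})" using poly_roots_finite by blast
  moreover have "insert 0 {t. poly q t = 0} = UNIV" using assms by auto
  ultimately show False using infinite_UNIV_char_0[where 'a = 'a] by simp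
qed

lemma minor_cleared_symbol_nonzero:
  assumes ij: "i < r" "j < r"
  obtains x z where "z \<noteq> 0" "Determinant.det (mat_delete (cleared_symbol p r b x z) i j) \<noteq> (0 :: complex)"
proof (rule ccontr)
  assume "\<not> thesis"
  with that have zero: "Determinant.det (mat_delete (cleared_symbol p r b x z) i j) = 0" if "z \<noteq> 0" for x z
    using \<open>z \<noteq> 0\<close> by blast
  \<comment> \<open>The polynomials in t that equal
    \<open>symbol_coeff b (2 / t) k j * t ^ k\<close> for \<open>t \<noteq> 0\<close>: the pole of x
    = 2/t is cancelled by the factor t at \<open>k = 1\<close>.\<close>
  define c where "c k j = (if k = 0 then 1 else if k = 1 then [:- 2, b 0 j:] else monom (b (k - 1) j) k)" for k j
  let ?q = "Determinant.det (mat_delete (wrap_mat r (p + 1) c) i j)"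
  have eval: "poly ?q t = Determinant.det (mat_delete (wrap_mat r (p + 1) (\<lambda>k j. poly (c k j) t)) i j)" for t
    using comm_ring_hom.hom_minor[OF comm_ring_hom_poly wrap_mat_carrier ij]
    unfolding comm_ring_hom.hom_wrap_mat[OF comm_ring_hom_poly] by metis
  have "?q = 0"
  proof (rule poly_zero_off_zero)
    fix t :: complex assume t: "t \<noteq> 0"
    have "poly (c k j) t = symbol_coeff b (2 / t) k j * t ^ k" for k j
      using t by (simp add: c_def symbol_coeff_def poly_monom left_diff_distrib right_diff_distrib mult.commute)
    then have "t ^ ((i + 1) mod r) * poly ?q t
        = t ^ j * Determinant.det (mat_delete (cleared_symbol p r b (2 / t) (t ^ r)) i j)"
      unfolding eval cleared_symbol_def minor_wrap_mat_rescale[OF t ij] by simp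
    also have "\<dots> = 0" using zero[of "t ^ r" "2 / t"] t by simp
    finally show "poly ?q t = 0" using t by simp
  qed
  \<comment> \<open>At t = 0 the matrix is the cyclic permutation matrix minus 2, none of whose
    minors of size r - 1 vanishes.\<close>
  then have "poly ?q 0 = 0" by simp
  moreover have "(\<lambda>k j. poly (c k j) 0) = (\<lambda>k j. if k = 0 then 1 else if k = 1 then - 2 else 0)"
    by (auto simp: fun_eq_iff c_def poly_monom)
  ultimately show False
    using minor_shifted_permutation_nonzero[of "p + 1" i r j] ij unfolding eval by simp
qed

text \<open>In \<open>complex poly poly\<close> the outer indeterminate is \<open>x\<close> and the inner one is \<open>z\<close>.\<close>

definition symbol_poly2 :: "nat \<Rightarrow> nat \<Rightarrow> (nat \<Rightarrow> nat \<Rightarrow> complex) \<Rightarrow> complex poly poly mat" where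
  "symbol_poly2 p r b = cleared_symbol p r (\<lambda>k j. [:[:b k j:]:]) [:0, 1:] [:[:0, 1:]:]"

lemma symbol_poly2_carrier [simp]: "symbol_poly2 p r b \<in> carrier_mat r r"
  by (simp add: symbol_poly2_def)

lemma poly_symbol_poly2: "map_mat (\<lambda>q. poly q [:x:]) (symbol_poly2 p r b) = symbol_poly p r b x"
  unfolding symbol_poly2_def symbol_poly_def comm_ring_hom.hom_cleared_symbol[OF comm_ring_hom_poly]
  by simp

lemma poly_det_symbol_poly2:
  "poly (Determinant.det (symbol_poly2 p r b)) [:x:] = Determinant.det (symbol_poly p r b x)"
  using comm_ring_hom.hom_det[OF comm_ring_hom_poly, of "[:x:]" "symbol_poly2 p r b"]
  by (simp add: poly_symbol_poly2)

lemma poly_minor_symbol_poly2: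
  "i < r \<Longrightarrow> j < r \<Longrightarrow> poly (Determinant.det (mat_delete (symbol_poly2 p r b) i j)) [:x:]
    = Determinant.det (mat_delete (symbol_poly p r b x) i j)"
  using comm_ring_hom.hom_minor[OF comm_ring_hom_poly symbol_poly2_carrier, of i r j "[:x:]"]
  by (simp add: poly_symbol_poly2)

lemma const_poly_power: "[:c:] ^ n = [:c ^ n :: 'a::comm_semiring_1:]"
  by (induction n) (auto simp: mult.commute)

lemma symbol_poly2_term:
  "symbol_coeff (\<lambda>k j. [:[:b k j:]:]) [:0, 1:] k j * [:[:0, 1:]:] ^ q
    = [:(if k = 0 then 1 else [:b (k - 1) j:]) * [:0, 1:] ^ q, (if k = 1 then - ([:0, 1:] ^ q) else 0):]"
  unfolding const_poly_power by (simp add: symbol_coeff_def)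

lemma degree_symbol_poly2_nth:
  assumes "i < r" "j < r"
  shows "degree (symbol_poly2 p r b $$ (i, j)) \<le> 1"
  unfolding symbol_poly2_def cleared_symbol_def wrap_mat_nth[OF assms]
  by (intro degree_sum_le) (auto simp: symbol_poly2_term simp del: mult_pCons_right power_Suc)

text \<open>x occurs only at \<open>k = 1\<close>, on the main diagonal; clearing the pole puts z
  into the last of these entries alone.\<close>

lemma coeff_symbol_poly2:
  "map_mat (\<lambda>q. coeff q 1) (symbol_poly2 p r b) = mat_diag r (\<lambda>j. - ([:0, 1:] ^ ((j + 1) div r)))"
proof (rule eq_matI)
  fix i j
  assume "i < dim_row (mat_diag r (\<lambda>j. - ([:0, 1 :: complex:] ^ ((j + 1) div r))))"
    "j < dim_col (mat_diag r (\<lambda>j. - ([:0, 1 :: complex:] ^ ((j + 1) div r))))"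
  then have ij: "i < r" "j < r" by (simp_all add: mat_diag_def)
  have coeff_term: "coeff (if (j + k) mod r = (i + 1) mod r
        then symbol_coeff (\<lambda>k j. [:[:b k j:]:]) [:0, 1:] k j * [:[:0, 1:]:] ^ ((j + k) div r) else 0) 1
      = (if k = 1 then (if i = j then - ([:0, 1:] ^ ((j + 1) div r)) else 0) else 0)" for k
  proof (cases "k = 1")
    case True
    have "(j + 1) mod r = (i + 1) mod r \<longleftrightarrow> i = j"
      using Suc_mod_eq_iff[OF ij(1), of j] ij(2) by (auto simp only: mod_less)
    then show ?thesis unfolding symbol_poly2_term using True by simp
  next
    case False
    then show ?thesis unfolding symbol_poly2_term by simp
  qed
  have "map_mat (\<lambda>q. coeff q 1) (symbol_poly2 p r b) $$ (i, j) = coeff (symbol_poly2 p r b $$ (i, j)) 1"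
    using ij carrier_matD[OF symbol_poly2_carrier[of p r b]] by simp
  also have "\<dots> = (\<Sum>k\<le>p + 1. if k = 1 then (if i = j then - ([:0, 1:] ^ ((j + 1) div r)) else 0) else 0)"
    unfolding symbol_poly2_def cleared_symbol_def wrap_mat_nth[OF ij] coeff_sum coeff_term ..
  also have "\<dots> = (if i = j then - ([:0, 1:] ^ ((j + 1) div r)) else 0)"
    by (subst sum.delta) auto
  finally show "map_mat (\<lambda>q. coeff q 1) (symbol_poly2 p r b) $$ (i, j)
      = mat_diag r (\<lambda>j. - ([:0, 1:] ^ ((j + 1) div r))) $$ (i, j)"
    using ij by (simp add: mat_diag_def)
qed (use carrier_matD[OF symbol_poly2_carrier[of p r b]] in \<open>auto simp: mat_diag_def\<close>)

lemma det_symbol_poly2_top: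
  assumes "r \<ge> 1"
  shows "degree (Determinant.det (symbol_poly2 p r b)) = r"
    and "coeff (Determinant.det (symbol_poly2 p r b)) r = Polynomial.smult ((-1) ^ r) [:0, 1:]"
proof -
  have le: "degree (Determinant.det (symbol_poly2 p r b)) \<le> r * 1"
    by (rule coeff_det_bounded(1)[OF symbol_poly2_carrier degree_symbol_poly2_nth])
  have "coeff (Determinant.det (symbol_poly2 p r b)) (r * 1)
      = Determinant.det (map_mat (\<lambda>q. coeff q 1) (symbol_poly2 p r b))"
    by (rule coeff_det_bounded(2)[OF symbol_poly2_carrier degree_symbol_poly2_nth])
  also have "\<dots> = (\<Prod>j<r. - ([:0, 1:] ^ ((j + 1) div r)))"
    unfolding coeff_symbol_poly2 det_mat_diag ..
  also have "\<dots> = (\<Prod>j<r. - 1) * (\<Prod>j<r. [:0, 1:] ^ ((j + 1) div r))"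
    unfolding prod.distrib[symmetric] by (simp only: mult_minus1)
  also have "(\<Prod>j<r. [:0, 1 :: complex:] ^ ((j + 1) div r)) = (\<Prod>j<r. if j = r - 1 then [:0, 1:] else 1)"
    by (intro prod.cong) auto
  also have "\<dots> = [:0, 1:]" using assms by (subst prod.delta) auto
  also have "(\<Prod>j<r. - 1) = [:(-1 :: complex) ^ r:]"
    unfolding const_poly_power[symmetric] by (simp add: one_pCons)
  finally show coeff: "coeff (Determinant.det (symbol_poly2 p r b)) r = Polynomial.smult ((-1) ^ r) [:0, 1:]" by simp
  then have "coeff (Determinant.det (symbol_poly2 p r b)) r \<noteq> 0" by simp
  then show "degree (Determinant.det (symbol_poly2 p r b)) = r" using le le_degree by fastforce
qed

lemma degree_minor_symbol_poly2:
  assumes ij: "i < r" "j < r"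
  shows "degree (Determinant.det (mat_delete (symbol_poly2 p r b) i j)) < r"
proof -
  have "degree (mat_delete (symbol_poly2 p r b) i j $$ (i', j')) \<le> 1" if "i' < r - 1" "j' < r - 1" for i' j'
    unfolding mat_delete_nth[OF symbol_poly2_carrier ij that]
    by (intro degree_symbol_poly2_nth insert_index_less ij that)
  from coeff_det_bounded(1)[OF mat_delete_carrier[OF symbol_poly2_carrier] this]
  have "degree (Determinant.det (mat_delete (symbol_poly2 p r b) i j)) \<le> (r - 1) * 1" by blast
  then show ?thesis using ij by simp
qed

section \<open>Irreducibility and elimination of x\<close>

lemma poly_map_poly_eval:
  fixes h :: "'a::comm_ring_1 poly poly"
  shows "poly (map_poly (\<lambda>c. poly c z) h) x = poly (poly h [:x:]) z"
  by (induction h) (auto simp: map_poly_pCons)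

lemma coeff_map_poly_eval: "coeff (map_poly (\<lambda>c. poly c z) h) n = poly (coeff h n) (z :: 'a::comm_ring_1)"
  by (simp add: coeff_map_poly)

text \<open>In a factorization some factor h has a leading coefficient free of z. At z = 0 the
  product is the constant e, so there h has degree 0 in x; its leading coefficient survives z = 0,
  so h itself is a nonzero constant.\<close>

lemma irreducible_poly_poly:
  fixes g :: "'a::field_char_0 poly poly"
  assumes "degree g > 0" and lc: "degree (lead_coeff g) = 1"
    and const: "e \<noteq> 0" "\<And>x. poly (poly g [:x:]) 0 = e"
  shows "irreducible g"
proof (rule irreducibleI)
  show "g \<noteq> 0" using \<open>degree g > 0\<close> by auto
  show "\<not> is_unit g" using \<open>degree g > 0\<close> by (auto simp: is_unit_poly_iff)
  have unit: "is_unit h" if gh: "g = h * h'" and dh: "degree (lead_coeff h) = 0" for h h'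
  proof -
    let ?ev = "map_poly (\<lambda>c. poly c 0)"
    have "poly (?ev h * ?ev h') x = poly [:e:] x" for x
      using const(2)[of x] gh by (simp add: poly_map_poly_eval)
    then have eq: "?ev h * ?ev h' = [:e:]" by (simp add: poly_eq_poly_eq_iff[symmetric] fun_eq_iff)
    have "?ev h \<noteq> 0" "?ev h' \<noteq> 0" using eq const(1) by auto
    then have "degree (?ev h) + degree (?ev h') = degree [:e:]"
      using degree_mult_eq[of "?ev h" "?ev h'"] by (simp only: eq not_False_eq_True)
    then have "degree (?ev h) = 0" by simp
    obtain c where c: "lead_coeff h = [:c:]" using dh by (rule degree_eq_zeroE)
    have "h \<noteq> 0" using \<open>g \<noteq> 0\<close> gh by auto
    then have "c \<noteq> 0" using c by (metis leading_coeff_0_iff pCons_0_0)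
    have "coeff (?ev h) (degree h) \<noteq> 0" unfolding coeff_map_poly_eval c using \<open>c \<noteq> 0\<close> by simp
    then have "degree h = 0" using \<open>degree (?ev h) = 0\<close> le_degree by fastforce
    then have "h = [:[:c:]:]" using c by (metis degree_eq_zeroE coeff_pCons_0)
    moreover have "c dvd 1" using \<open>c \<noteq> 0\<close> by (intro dvdI[of _ _ "inverse c"]) simp
    ultimately show ?thesis by (simp add: is_unit_poly_iff)
  qed
  fix h h' assume g: "g = h * h'"
  have "lead_coeff h * lead_coeff h' = lead_coeff g" using g by (simp add: lead_coeff_mult)
  moreover have "lead_coeff h \<noteq> 0" "lead_coeff h' \<noteq> 0" using g \<open>g \<noteq> 0\<close> by auto
  ultimately have "degree (lead_coeff h) + degree (lead_coeff h') = 1"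
    using lc degree_mult_eq by metis
  then have "degree (lead_coeff h) = 0 \<or> degree (lead_coeff h') = 0" by linarith
  then show "is_unit h \<or> is_unit h'" using unit[of h h'] unit[of h' h] g by (auto simp: mult.commute)
qed

text \<open>Euclid's algorithm with pseudo-division stays inside the coefficient ring; primality of
  \<open>g\<close> keeps it from stopping before a constant is reached.\<close>

lemma prime_elem_bezout:
  fixes g D :: "'a::idom poly"
  assumes prime: "prime_elem g"
  shows "D \<noteq> 0 \<Longrightarrow> degree D < degree g \<Longrightarrow> \<exists>c u v. c \<noteq> 0 \<and> [:c:] = u * g + v * D"
proof (induction "degree D" arbitrary: D rule: less_induct)
  case less
  show ?case
  proof (cases "degree D = 0")
    case True
    then obtain c where "D = [:c:]" by (rule degree_eq_zeroE)
    then have "c \<noteq> 0 \<and> [:c:] = 0 * g + 1 * D" using less.prems by auto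
    then show ?thesis by blast
  next
    case False
    define R where "R = pseudo_mod g D"
    obtain a q where a: "a \<noteq> 0" "Polynomial.smult a g = D * q + R"
      using pseudo_mod(1)[OF \<open>D \<noteq> 0\<close>, of g] unfolding R_def by blast
    \<comment> \<open>A zero remainder gives that \<open>g\<close> divides \<open>D * q\<close>,
      hence \<open>q\<close>, since \<open>D\<close> has smaller degree. Then \<open>[:a:]\<close>
      would be a multiple of the nonconstant \<open>D\<close>.\<close>
    have "R \<noteq> 0"
    proof
      assume "R = 0"
      then have Dq: "Polynomial.smult a g = D * q" using a by simp
      then have "g dvd D * q" by (metis dvd_smult dvd_refl)
      moreover have "\<not> g dvd D"
        using dvd_imp_degree_le[of g D] less.prems by auto
      ultimately have "g dvd q" using prime_elem_dvd_multD[OF prime] by blast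
      then obtain q' where "q = g * q'" by (rule dvdE)
      then have "g * [:a:] = g * (D * q')" using Dq by (simp add: mult.left_commute)
      moreover have "g \<noteq> 0" using prime by auto
      ultimately have eq: "[:a:] = D * q'" using mult_left_cancel by blast
      then have "q' \<noteq> 0" using a by auto
      then have "degree [:a:] = degree D + degree q'" unfolding eq using less.prems(1) by (simp add: degree_mult_eq)
      then show False using False by simp
    qed
    then have lt: "degree R < degree D" using pseudo_mod(2)[OF \<open>D \<noteq> 0\<close>, of g] unfolding R_def by blast
    then obtain c u v where c: "c \<noteq> 0" "[:c:] = u * g + v * R"
      using less.hyps[OF lt \<open>R \<noteq> 0\<close>] less.prems by (meson order.strict_trans)
    have "R = [:a:] * g - D * q" using a by simp
    then have "[:c:] = (u + v * [:a:]) * g + (- v * q) * D"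
      using c(2) by (simp only: distrib_right right_diff_distrib mult.assoc mult.commute[of q D] mult_minus_left) simp
    then show ?thesis using c by blast
  qed
qed

text \<open>The Bezout constant eliminates x: every such z is a root of the nonzero polynomial
  \<open>c\<close>.\<close>

lemma finite_common_zeros:
  fixes g D :: "'a::field_char_0 poly poly"
  assumes "prime_elem g" "D \<noteq> 0" "degree D < degree g"
  shows "finite {z. \<exists>x. poly (poly g [:x:]) z = 0 \<and> poly (poly D [:x:]) z = 0}"
proof -
  obtain c u v where c: "c \<noteq> 0" "[:c:] = u * g + v * D"
    using prime_elem_bezout[OF assms] by blast
  have "poly c z = 0" if "poly (poly g [:x:]) z = 0" "poly (poly D [:x:]) z = 0" for x z
  proof -
    have "poly (poly [:c:] [:x:]) z = 0" unfolding c(2) using that by simp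
    then show ?thesis by simp
  qed
  then have "{z. \<exists>x. poly (poly g [:x:]) z = 0 \<and> poly (poly D [:x:]) z = 0} \<subseteq> {z. poly c z = 0}" by auto
  then show ?thesis using poly_roots_finite[OF c(1)] finite_subset by blast
qed

text \<open>\<open>w\<close> may pick any root for each x. Zeros of the minor lead into the finite
  set of common z, and each nonzero z comes from finitely many x.\<close>

lemma finite_zeros_minor_root:
  assumes "r \<ge> 1" and ij: "i < r" "j < r"
    and w: "\<And>x. w x \<noteq> 0" "\<And>x. symbol_det p r b (w x) x = 0"
  shows "finite {x. symbol_minor p r b i j (w x) x = 0}"
proof -
  let ?g = "Determinant.det (symbol_poly2 p r b)"
  let ?D = "Determinant.det (mat_delete (symbol_poly2 p r b) i j)"
  note top = det_symbol_poly2_top[OF \<open>r \<ge> 1\<close>, of p b]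
  have g: "poly (poly ?g [:x:]) z = z * symbol_det p r b z x" if "z \<noteq> 0" for x z
    unfolding poly_det_symbol_poly2 poly_det_symbol_poly by (rule det_cleared_symbol[OF \<open>r \<ge> 1\<close> that])
  have D: "poly (poly ?D [:x:]) z = (if i = r - 1 then 1 else z) * symbol_minor p r b i j z x"
    if "z \<noteq> 0" for x z
    unfolding poly_minor_symbol_poly2[OF ij] poly_minor_symbol_poly[OF ij]
    by (rule minor_cleared_symbol[OF \<open>r \<ge> 1\<close> that ij])
  have "irreducible ?g"
  proof (rule irreducible_poly_poly)
    show "degree (lead_coeff ?g) = 1" unfolding top by simp
    show "poly (poly ?g [:x:]) 0 = (-1) ^ (r - 1)" for x
      unfolding poly_det_symbol_poly2 by (rule poly_det_symbol_poly_0[OF \<open>r \<ge> 1\<close>])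
  qed (use \<open>r \<ge> 1\<close> top(1) in auto)
  \<comment> \<open>Polynomials in x over the polynomials in z form a GCD domain, where irreducible
    elements are prime.\<close>
  then have "prime_elem ?g" by (rule irreducible_imp_prime_elem_gcd)
  moreover have "?D \<noteq> 0"
  proof
    assume "?D = 0"
    obtain x z where "Determinant.det (mat_delete (cleared_symbol p r b x z) i j) \<noteq> 0"
      by (rule minor_cleared_symbol_nonzero[OF ij])
    then have "poly (poly ?D [:x:]) z \<noteq> 0"
      unfolding poly_minor_symbol_poly2[OF ij] poly_minor_symbol_poly[OF ij] .
    then show False using \<open>?D = 0\<close> by simp
  qed
  moreover have "degree ?D < degree ?g" unfolding top(1) by (rule degree_minor_symbol_poly2[OF ij])
  ultimately have "finite {z. \<exists>x. poly (poly ?g [:x:]) z = 0 \<and> poly (poly ?D [:x:]) z = 0}" (is "finite ?Z")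
    by (rule finite_common_zeros)
  moreover have "finite {x. poly (poly ?g [:x:]) z = 0}" if "z \<noteq> 0" for z
  proof -
    \<comment> \<open>The coefficient of x^r is z up to sign, so for nonzero z the polynomial in x
      is not zero.\<close>
    have "coeff (map_poly (\<lambda>c. poly c z) ?g) r \<noteq> 0"
      unfolding coeff_map_poly_eval top(2) using that by simp
    then have "map_poly (\<lambda>c. poly c z) ?g \<noteq> 0" by auto
    from poly_roots_finite[OF this] show ?thesis unfolding poly_map_poly_eval .
  qed
  ultimately have "finite (\<Union>z\<in>?Z - {0}. {x. poly (poly ?g [:x:]) z = 0})" by auto
  moreover have "{x. symbol_minor p r b i j (w x) x = 0} \<subseteq> (\<Union>z\<in>?Z - {0}. {x. poly (poly ?g [:x:]) z = 0})"
  proof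
    fix x assume "x \<in> {x. symbol_minor p r b i j (w x) x = 0}"
    then have "poly (poly ?D [:x:]) (w x) = 0" "poly (poly ?g [:x:]) (w x) = 0"
      using g[OF w(1)] D[OF w(1)] w(2) by simp_all
    then show "x \<in> (\<Union>z\<in>?Z - {0}. {x. poly (poly ?g [:x:]) z = 0})" using w(1)[of x] by blast
  qed
  ultimately show ?thesis by (rule finite_subset[rotated])
qed

theorem theorem2p14:
  fixes p r :: nat
    and a b :: "nat \<Rightarrow> nat \<Rightarrow> complex"
    and H :: "nat \<Rightarrow> nat \<Rightarrow> complex"
    and z :: "complex \<Rightarrow> nat \<Rightarrow> complex"
  assumes "p \<ge> 1" and "r \<ge> 1"
    and "H = hessenberg p a"
    and "exactly_periodic p r b a"
    and "\<forall>k<r. b p k \<noteq> 0"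
    and "\<forall>x. ordered_roots p r b x (z x)"
  shows "(\<forall>x. inj_on (z x) {..p} \<longrightarrow>
            (\<forall>n. \<forall>j<r.
               Q H (r * n + j) x =
                 (-1) ^ (r + j) / lead_const p r b *
                 (\<Sum>k\<le>p. symbol_minor p r b (r - 1) j (z x k) x
                           / (\<Prod>i\<in>{..p} - {k}. z x k - z x i)
                           * z x k powi (- int n - 1))))
       \<and> (\<forall>i<r. \<forall>j<r. \<forall>k\<le>p. finite {x. symbol_minor p r b i j (z x k) x = 0})"
proof -
  have nz: "z x k \<noteq> 0" and root: "symbol_det p r b (z x k) x = 0" if "k \<le> p" for x k
    using assms(6) that by (auto simp: ordered_roots_def)
  show ?thesis
    unfolding \<open>H = hessenberg p a\<close>
    by (intro conjI allI impI Q_eq_sum_roots[OF assms(1,2,4,5)] finite_zeros_minor_root[OF \<open>r \<ge> 1\<close>] nz root)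
qed

end
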